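(* Let $\mathbf w^\star$ be an optimal point of the optimal control problem and suppose Assumptions 1 (stated in the context) hold with neighbourhoods $\mathcal N_t$ of $w_t^\star$. Then there exist positive scalars $\epsilon$ and $M$ such that for every current iterate $\bar{\mathbf w}\in\mathcal N_1\times\dots\times\mathcal N_N$ with $\bar x_1=\hat x_1$, $\bar x_{t+1}=f(\bar x_t,\bar u_t)$ for $t\in[N-1]$, and $\|\mathbf w^\star-\bar{\mathbf w}\|<\epsilon$, the FilterDDP full-step update $\mathbf w^+=\mathbf w^+(1)$ computed from $\bar{\mathbf w}$ satisfies $$\|\mathbf w^\star-\mathbf w^+\|\le M\|\mathbf w^\star-\bar{\mathbf w}\|^2,$$ and furthermore, if $\bar{\mathbf w}\neq\mathbf w^\star$, $$\|\mathbf w^\star-\mathbf w^+\|<\|\mathbf w^\star-\bar{\mathbf w}\|.$$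
   Context: Notation: $[N]=\{1,\dots,N\}$. Gradients of scalar functions are row vectors; for vector-valued $g$ with values in $\mathbb R^c$, $\nabla_x g\in\mathbb R^{c\times n}$ and second derivatives are tensors whose first dimension indexes the components of $g$; for a vector $v$ (row or column), $v\cdot g_{yz}=\sum_i v^{(i)}\nabla^2_{yz}g_i$ (contraction along the first dimension). Problem: the discrete-time optimal control problem of minimising $\sum_{t=1}^N\ell(x_t,u_t)$ subject to $x_1=\hat x_1$, $x_{t+1}=f(x_t,u_t)$ for $t\in[N-1]$, and $c(x_t,u_t)=0$ for $t\in[N]$, where $x_t\in\mathbb R^{n_x}$, $u_t\in\mathbb R^{n_u}$, $\ell:\mathbb R^{n_x}\times\mathbb R^{n_u}\to\mathbb R$, $f:\mathbb R^{n_x}\times\mathbb R^{n_u}\to\mathbb R^{n_x}$, $c:\mathbb R^{n_x}\times\mathbb R^{n_u}\to\mathbb R^{n_c}$, $n_c\le n_u$, all twice continuously differentiable. Let $L(x,u,\phi):=\ell(x,u)+\phi^\top c(x,u)$ with $\phi\in\mathbb R^{n_c}$, and write $w_t=(x_t,u_t,\phi_t)$, $\mathbf w=(w_t)_{t=1}^N$. A bar denotes evaluation at the current iterate $\bar{\mathbf w}=(\bar x_t,\bar u_t,\bar\phi_t)_{t=1}^N$: $\bar h^t=h(\bar x_t,\bar u_t,\bar\phi_t)$, $\bar h^t_y=\nabla_y h(\bar x_t,\bar u_t,\bar\phi_t)$, and similarly for second derivatives. Optimal point: $\mathbf w^\star=(x_t^\star,u_t^\star,\phi_t^\star)_{t=1}^N$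 is an optimal point if $(x^\star_{1:N},u^\star_{1:N})$ is a local solution and, together with $\phi^\star_{1:N}$ and some $\lambda_{1:N}$ (with $\lambda_{N+1}:=0$), satisfies the KKT conditions: for all $t\in[N]$, $L_x^t-\lambda_t^\top+\lambda_{t+1}^\top f_x^t=0$, $L_u^t+\lambda_{t+1}^\top f_u^t=0$, $c(x_t^\star,u_t^\star)=0$ (derivatives evaluated at $w_t^\star$), and $x_1^\star=\hat x_1$, $x^\star_{t+1}=f(x^\star_t,u^\star_t)$ for $t\in[N-1]$. Backward pass of FilterDDP at $\bar{\mathbf w}$: set $\bar\lambda_{N+1}=0\in\mathbb R^{n_x}$, $\bar V_x^{N+1}=0\in\mathbb R^{1\times n_x}$, $P_{N+1}=0\in\mathbb R^{n_x\times n_x}$. For $t=N,\dots,1$ put $A_t=(\bar c_u^t)^\top$, $\bar Q_x^t=\bar L_x^t+\bar V_x^{t+1}\bar f_x^t$, $\bar Q_u^t=\bar L_u^t+\bar V_x^{t+1}\bar f_u^t$, $H_t=\bar L_{uu}^t+(\bar f_u^t)^\top P_{t+1}\bar f_u^t+\bar\lambda_{t+1}\cdot\bar f_{uu}^t$, $B_t=\bar L_{ux}^t+(\bar f_u^t)^\top P_{t+1}\bar f_x^t+\bar\lambda_{t+1}\cdot\bar f_{ux}^t$, $C_t=\bar L_{xx}^t+(\bar f_x^t)^\top P_{t+1}\bar f_x^t+\bar\lambda_{t+1}\cdot\bar f_{xx}^t$, and let $\alpha_t,\beta_t,\psi_t,\omega_t$ solve $$K_t\begin{bmatrix}\alpha_t&\beta_t\\\psi_t&\omega_t\end{bmatrix}=-\begin{bmatrix}(\bar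 Q_u^t)^\top&B_t\\\bar c^t&\bar c_x^t\end{bmatrix},\qquad K_t=\begin{bmatrix}H_t&A_t\\ A_t^\top&0\end{bmatrix}.$$ (In general FilterDDP adds an inertia correction $\delta_wI$ to the top-left block and $-\delta_cI$ to the bottom-right block; under Assumptions 1 none is applied, so $\delta_w=\delta_c=0$, and $K_t$ is non-singular.) Then set $\bar V_x^t=\bar Q_x^t+\bar Q_u^t\beta_t+(\bar c^t)^\top\omega_t$, $\bar\lambda_t^\top=\bar L_x^t+\bar\lambda_{t+1}^\top\bar f_x^t$, $P_t=C_t+\beta_t^\top H_t\beta_t+B_t^\top\beta_t+\beta_t^\top B_t$. Forward pass with full step $\gamma=1$ (the analysis assumes full steps are always accepted by the filter): $x_1^+=\hat x_1$, $u_t^+=\bar u_t+\alpha_t+\beta_t(x_t^+-\bar x_t)$, $\phi_t^+=\bar\phi_t+\psi_t+\omega_t(x_t^+-\bar x_t)$, $x_{t+1}^+=f(x_t^+,u_t^+)$, and $\mathbf w^+=\mathbf w^+(1)=(x_t^+,u_t^+,\phi_t^+)_{t=1}^N$. Assumptions 1: for all $t\in[N]$ there is an open convex neighbourhood $\mathcal N_t$ containing $w_t^\star$ and the current iterate $\bar w_t$ such that, for all $w_t\in\mathcal N_t$ and all $t\in[N]$ (quantities $A_t,H_t$ being those of the backward pass evaluated at $\mathbf w\in\mathcal N_1\times\dots\times\mathcal N_N$): (1A) $\ell,f,c$ and their first derivatives are Lipschitz continuously differentiable (so first and second derivatives are Lipschitz); (1B) the minimum singular value of $A_t$ is uniformly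 bounded away from zero; (1C) $\xi^\top H_t\xi>0$ for all nonzero $\xi$ in the null space of $A_t^\top$, i.e. all nonzero $\xi\in\mathbb R^{n_u}$ with $A_t^\top\xi=0$. *)

theory Defs
  imports "HOL-Analysis.Analysis"
begin

text \<open>
  Row vectors (gradients, \<open>V\<^sub>x\<close>, \<open>Q\<^sub>x\<close>, \<open>Q\<^sub>u\<close>) are elements of \<open>real^'n\<close>; a row vector \<open>v\<close>
  times a matrix \<open>M\<close> is \<open>v v* M\<close>.
\<close>

definition twice_cont_diff ::
  "('a::real_normed_vector \<Rightarrow> 'b::real_normed_vector) \<Rightarrow> bool" where
  "twice_cont_diff g \<longleftrightarrow>
     (\<exists>(g' :: 'a \<Rightarrow> 'a \<Rightarrow>\<^sub>L 'b) (g'' :: 'a \<Rightarrow> 'a \<Rightarrow>\<^sub>L ('a \<Rightarrow>\<^sub>L 'b)).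
        (\<forall>z. (g has_derivative blinfun_apply (g' z)) (at z)) \<and>
        (\<forall>z. (g' has_derivative blinfun_apply (g'' z)) (at z)) \<and>
        continuous_on UNIV g'')"

text \<open>Only meant for open \<open>S\<close>, as the derivatives at the points of \<open>S\<close> are unrestricted ones.\<close>

definition lipschitz_derivs_on ::
  "'a::real_normed_vector set \<Rightarrow> ('a \<Rightarrow> 'b::real_normed_vector) \<Rightarrow> bool" where
  "lipschitz_derivs_on S g \<longleftrightarrow>
     (\<exists>(g' :: 'a \<Rightarrow> 'a \<Rightarrow>\<^sub>L 'b) (g'' :: 'a \<Rightarrow> 'a \<Rightarrow>\<^sub>L ('a \<Rightarrow>\<^sub>L 'b)).
        (\<forall>z\<in>S. (g has_derivative blinfun_apply (g' z)) (at z)) \<and>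
        (\<forall>z\<in>S. (g' has_derivative blinfun_apply (g'' z)) (at z)) \<and>
        (\<exists>K. K-lipschitz_on S g') \<and> (\<exists>K. K-lipschitz_on S g''))"

definition gradient :: "(real^'n \<Rightarrow> real) \<Rightarrow> real^'n \<Rightarrow> real^'n" where
  "gradient g z = (\<chi> i. frechet_derivative g (at z) (axis i 1))"

definition grad_x :: "((real^'x) \<times> (real^'u) \<Rightarrow> real) \<Rightarrow> (real^'x) \<times> (real^'u) \<Rightarrow> real^'x" where
  "grad_x g z = gradient (\<lambda>x. g (x, snd z)) (fst z)"

definition grad_u :: "((real^'x) \<times> (real^'u) \<Rightarrow> real) \<Rightarrow> (real^'x) \<times> (real^'u) \<Rightarrow> real^'u" where
  "grad_u g z = gradient (\<lambda>u. g (fst z, u)) (snd z)"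

definition jac_x :: "((real^'x) \<times> (real^'u) \<Rightarrow> real^'m) \<Rightarrow> (real^'x) \<times> (real^'u) \<Rightarrow> real^'x^'m" where
  "jac_x g z = jacobian (\<lambda>x. g (x, snd z)) (at (fst z))"

definition jac_u :: "((real^'x) \<times> (real^'u) \<Rightarrow> real^'m) \<Rightarrow> (real^'x) \<times> (real^'u) \<Rightarrow> real^'u^'m" where
  "jac_u g z = jacobian (\<lambda>u. g (fst z, u)) (at (snd z))"

definition hess_xx :: "((real^'x) \<times> (real^'u) \<Rightarrow> real) \<Rightarrow> (real^'x) \<times> (real^'u) \<Rightarrow> real^'x^'x" where
  "hess_xx g z = jacobian (\<lambda>x. grad_x g (x, snd z)) (at (fst z))"

text \<open>Rows of \<open>hess_ux\<close> are indexed by the components of \<open>u\<close>, columns by those of \<open>x\<close>.\<close>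

definition hess_ux :: "((real^'x) \<times> (real^'u) \<Rightarrow> real) \<Rightarrow> (real^'x) \<times> (real^'u) \<Rightarrow> real^'x^'u" where
  "hess_ux g z = jacobian (\<lambda>x. grad_u g (x, snd z)) (at (fst z))"

definition hess_uu :: "((real^'x) \<times> (real^'u) \<Rightarrow> real) \<Rightarrow> (real^'x) \<times> (real^'u) \<Rightarrow> real^'u^'u" where
  "hess_uu g z = jacobian (\<lambda>u. grad_u g (fst z, u)) (at (snd z))"

definition contract :: "real^'m \<Rightarrow> ('m \<Rightarrow> real^'j^'i) \<Rightarrow> real^'j^'i" where
  "contract v T = (\<Sum>i\<in>UNIV. v $ i *\<^sub>R T i)"

text \<open>
  For a matrix with at least as many rows as columns: the square roots of the
  eigenvalues of \<open>A\<^sup>T A\<close>. This is a finite nonempty set, so its infimum is its minimum.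
\<close>

definition singular_values :: "real^'c^'u \<Rightarrow> real set" where
  "singular_values A = {s. 0 \<le> s \<and> (\<exists>v. v \<noteq> 0 \<and> (transpose A ** A) *v v = s\<^sup>2 *\<^sub>R v)}"

definition min_singular_value :: "real^'c^'u \<Rightarrow> real" where
  "min_singular_value A = Inf (singular_values A)"

text \<open>
  A point \<open>w\<^sub>t = (x\<^sub>t, u\<^sub>t, \<phi>\<^sub>t)\<close> is a triple. Trajectories are functions on \<open>nat\<close>
  of which only the values at \<open>1, \<dots>, N\<close> matter.
\<close>

type_synonym ('x, 'u) xupoint = "(real^'x) \<times> (real^'u)"
type_synonym ('x, 'u, 'c) point = "(real^'x) \<times> (real^'u) \<times> (real^'c)"

definition xu :: "('x::finite, 'u::finite, 'c::finite) point \<Rightarrow> ('x, 'u) xupoint" where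
  "xu p = (fst p, fst (snd p))"

definition mult :: "('x::finite, 'u::finite, 'c::finite) point \<Rightarrow> real^'c" where
  "mult p = snd (snd p)"

definition traj_dist :: "nat \<Rightarrow> (nat \<Rightarrow> 'a::metric_space) \<Rightarrow> (nat \<Rightarrow> 'a) \<Rightarrow> real" where
  "traj_dist N v w = L2_set (\<lambda>t. dist (v t) (w t)) {1..N}"

definition feasible_dyn ::
  "(('x::finite, 'u::finite) xupoint \<Rightarrow> real^'x) \<Rightarrow> nat \<Rightarrow> real^'x \<Rightarrow> (nat \<Rightarrow> ('x, 'u) xupoint) \<Rightarrow> bool"
where
  "feasible_dyn f N x1 z \<longleftrightarrow> fst (z 1) = x1 \<and> (\<forall>t\<in>{1..<N}. fst (z (Suc t)) = f (z t))"

definition feasible ::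
  "(('x::finite, 'u::finite) xupoint \<Rightarrow> real^'x) \<Rightarrow> (('x, 'u) xupoint \<Rightarrow> real^'c::finite) \<Rightarrow>
   nat \<Rightarrow> real^'x \<Rightarrow> (nat \<Rightarrow> ('x, 'u) xupoint) \<Rightarrow> bool"
where
  "feasible f c N x1 z \<longleftrightarrow> feasible_dyn f N x1 z \<and> (\<forall>t\<in>{1..N}. c (z t) = 0)"

definition total_cost ::
  "(('x::finite, 'u::finite) xupoint \<Rightarrow> real) \<Rightarrow> nat \<Rightarrow> (nat \<Rightarrow> ('x, 'u) xupoint) \<Rightarrow> real"
where
  "total_cost l N z = (\<Sum>t=1..N. l (z t))"

definition local_solution ::
  "(('x::finite, 'u::finite) xupoint \<Rightarrow> real) \<Rightarrow> (('x, 'u) xupoint \<Rightarrow> real^'x) \<Rightarrow>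
   (('x, 'u) xupoint \<Rightarrow> real^'c::finite) \<Rightarrow> nat \<Rightarrow> real^'x \<Rightarrow> (nat \<Rightarrow> ('x, 'u) xupoint) \<Rightarrow> bool"
where
  "local_solution l f c N x1 z \<longleftrightarrow>
     feasible f c N x1 z \<and>
     (\<exists>r>0. \<forall>y. feasible f c N x1 y \<and> traj_dist N z y < r \<longrightarrow> total_cost l N z \<le> total_cost l N y)"

definition lagrangian ::
  "(('x::finite, 'u::finite) xupoint \<Rightarrow> real) \<Rightarrow> (('x, 'u) xupoint \<Rightarrow> real^'c::finite) \<Rightarrow>
   real^'c \<Rightarrow> ('x, 'u) xupoint \<Rightarrow> real"
where
  "lagrangian l c \<phi> z = l z + \<phi> \<bullet> c z"

definition optimal_point ::
  "(('x::finite, 'u::finite) xupoint \<Rightarrow> real) \<Rightarrow> (('x, 'u) xupoint \<Rightarrow> real^'x) \<Rightarrow>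
   (('x, 'u) xupoint \<Rightarrow> real^'c::finite) \<Rightarrow> nat \<Rightarrow> real^'x \<Rightarrow> (nat \<Rightarrow> ('x, 'u, 'c) point) \<Rightarrow> bool"
where
  "optimal_point l f c N x1 w \<longleftrightarrow>
     local_solution l f c N x1 (\<lambda>t. xu (w t)) \<and>
     (\<exists>lam :: nat \<Rightarrow> real^'x.
        lam (Suc N) = 0 \<and>
        (\<forall>t\<in>{1..N}.
           grad_x (lagrangian l c (mult (w t))) (xu (w t)) - lam t
             + lam (Suc t) v* jac_x f (xu (w t)) = 0 \<and>
           grad_u (lagrangian l c (mult (w t))) (xu (w t))
             + lam (Suc t) v* jac_u f (xu (w t)) = 0 \<and>
           c (xu (w t)) = 0) \<and>
        feasible_dyn f N x1 (\<lambda>t. xu (w t)))"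

text \<open>
  In the following, \<open>p\<close> is the point of the current iterate at time \<open>t\<close> and \<open>lam\<close>, \<open>V\<close>, \<open>P\<close>
  are the quantities \<open>\<lambda>\<close>, \<open>V\<^sub>x\<close>, \<open>P\<close> at time \<open>t + 1\<close>.
\<close>

definition A_mat ::
  "(('x::finite, 'u::finite) xupoint \<Rightarrow> real^'c::finite) \<Rightarrow> ('x, 'u, 'c) point \<Rightarrow> real^'c^'u"
where
  "A_mat c p = transpose (jac_u c (xu p))"

definition Qx_vec ::
  "(('x::finite, 'u::finite) xupoint \<Rightarrow> real) \<Rightarrow> (('x, 'u) xupoint \<Rightarrow> real^'x) \<Rightarrow>
   (('x, 'u) xupoint \<Rightarrow> real^'c::finite) \<Rightarrow> ('x, 'u, 'c) point \<Rightarrow> real^'x \<Rightarrow> real^'x"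
where
  "Qx_vec l f c p V = grad_x (lagrangian l c (mult p)) (xu p) + V v* jac_x f (xu p)"

definition Qu_vec ::
  "(('x::finite, 'u::finite) xupoint \<Rightarrow> real) \<Rightarrow> (('x, 'u) xupoint \<Rightarrow> real^'x) \<Rightarrow>
   (('x, 'u) xupoint \<Rightarrow> real^'c::finite) \<Rightarrow> ('x, 'u, 'c) point \<Rightarrow> real^'x \<Rightarrow> real^'u"
where
  "Qu_vec l f c p V = grad_u (lagrangian l c (mult p)) (xu p) + V v* jac_u f (xu p)"

definition H_mat ::
  "(('x::finite, 'u::finite) xupoint \<Rightarrow> real) \<Rightarrow> (('x, 'u) xupoint \<Rightarrow> real^'x) \<Rightarrow>
   (('x, 'u) xupoint \<Rightarrow> real^'c::finite) \<Rightarrow> ('x, 'u, 'c) point \<Rightarrow> real^'x \<Rightarrow> real^'x^'x \<Rightarrow> real^'u^'u"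
where
  "H_mat l f c p lam P =
     hess_uu (lagrangian l c (mult p)) (xu p)
     + transpose (jac_u f (xu p)) ** P ** jac_u f (xu p)
     + contract lam (\<lambda>i. hess_uu (\<lambda>z. f z $ i) (xu p))"

definition B_mat ::
  "(('x::finite, 'u::finite) xupoint \<Rightarrow> real) \<Rightarrow> (('x, 'u) xupoint \<Rightarrow> real^'x) \<Rightarrow>
   (('x, 'u) xupoint \<Rightarrow> real^'c::finite) \<Rightarrow> ('x, 'u, 'c) point \<Rightarrow> real^'x \<Rightarrow> real^'x^'x \<Rightarrow> real^'x^'u"
where
  "B_mat l f c p lam P =
     hess_ux (lagrangian l c (mult p)) (xu p)
     + transpose (jac_u f (xu p)) ** P ** jac_x f (xu p)
     + contract lam (\<lambda>i. hess_ux (\<lambda>z. f z $ i) (xu p))"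

definition C_mat ::
  "(('x::finite, 'u::finite) xupoint \<Rightarrow> real) \<Rightarrow> (('x, 'u) xupoint \<Rightarrow> real^'x) \<Rightarrow>
   (('x, 'u) xupoint \<Rightarrow> real^'c::finite) \<Rightarrow> ('x, 'u, 'c) point \<Rightarrow> real^'x \<Rightarrow> real^'x^'x \<Rightarrow> real^'x^'x"
where
  "C_mat l f c p lam P =
     hess_xx (lagrangian l c (mult p)) (xu p)
     + transpose (jac_x f (xu p)) ** P ** jac_x f (xu p)
     + contract lam (\<lambda>i. hess_xx (\<lambda>z. f z $ i) (xu p))"

text \<open>
  The four blocks of the linear system with coefficient matrix \<open>K = [[H, A], [A\<^sup>T, 0]]\<close>,
  unknowns \<open>[[\<alpha>, \<beta>], [\<psi>, \<omega>]]\<close> and right-hand side \<open>- [[Qu\<^sup>T, B], [cv, cx]]\<close>.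
\<close>

definition kkt_solution ::
  "real^'u^'u \<Rightarrow> real^'c^'u \<Rightarrow> real^'u \<Rightarrow> real^'x^'u \<Rightarrow> real^'c \<Rightarrow> real^'x^'c \<Rightarrow>
   (real^'u) \<times> (real^'x^'u) \<times> (real^'c) \<times> (real^'x^'c) \<Rightarrow> bool"
where
  "kkt_solution H A Qu B cv cx = (\<lambda>(\<alpha>, \<beta>, \<psi>, \<omega>).
     H *v \<alpha> + A *v \<psi> = - Qu \<and> H ** \<beta> + A ** \<omega> = - B \<and>
     transpose A *v \<alpha> = - cv \<and> transpose A ** \<beta> = - cx)"

text \<open>The result is unspecified if \<open>K\<close> is singular; otherwise the solution is unique.\<close>

definition gains ::
  "(('x::finite, 'u::finite) xupoint \<Rightarrow> real) \<Rightarrow> (('x, 'u) xupoint \<Rightarrow> real^'x) \<Rightarrow>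
   (('x, 'u) xupoint \<Rightarrow> real^'c::finite) \<Rightarrow> ('x, 'u, 'c) point \<Rightarrow>
   (real^'x) \<times> (real^'x) \<times> (real^'x^'x) \<Rightarrow>
   (real^'u) \<times> (real^'x^'u) \<times> (real^'c) \<times> (real^'x^'c)"
where
  "gains l f c p = (\<lambda>(lam, V, P).
     SOME s. kkt_solution (H_mat l f c p lam P) (A_mat c p) (Qu_vec l f c p V)
               (B_mat l f c p lam P) (c (xu p)) (jac_x c (xu p)) s)"

definition backward_step ::
  "(('x::finite, 'u::finite) xupoint \<Rightarrow> real) \<Rightarrow> (('x, 'u) xupoint \<Rightarrow> real^'x) \<Rightarrow>
   (('x, 'u) xupoint \<Rightarrow> real^'c::finite) \<Rightarrow> ('x, 'u, 'c) point \<Rightarrow>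
   (real^'x) \<times> (real^'x) \<times> (real^'x^'x) \<Rightarrow> (real^'x) \<times> (real^'x) \<times> (real^'x^'x)"
where
  "backward_step l f c p = (\<lambda>(lam, V, P).
     let (\<alpha>, \<beta>, \<psi>, \<omega>) = gains l f c p (lam, V, P);
         H = H_mat l f c p lam P;
         B = B_mat l f c p lam P;
         C = C_mat l f c p lam P
     in (grad_x (lagrangian l c (mult p)) (xu p) + lam v* jac_x f (xu p),
         Qx_vec l f c p V + Qu_vec l f c p V v* \<beta> + c (xu p) v* \<omega>,
         C + transpose \<beta> ** H ** \<beta> + transpose B ** \<beta> + transpose \<beta> ** B))"

text \<open>\<open>backward l f c N w t\<close> is the triple \<open>(\<lambda>\<^sub>t, V\<^sub>x\<^sup>t, P\<^sub>t)\<close> computed at the iterate \<open>w\<close>.\<close>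

function backward ::
  "(('x::finite, 'u::finite) xupoint \<Rightarrow> real) \<Rightarrow> (('x, 'u) xupoint \<Rightarrow> real^'x) \<Rightarrow>
   (('x, 'u) xupoint \<Rightarrow> real^'c::finite) \<Rightarrow> nat \<Rightarrow> (nat \<Rightarrow> ('x, 'u, 'c) point) \<Rightarrow> nat \<Rightarrow>
   (real^'x) \<times> (real^'x) \<times> (real^'x^'x)"
where
  "backward l f c N w t =
     (if t > N then (0, 0, 0)
      else backward_step l f c (w t) (backward l f c N w (Suc t)))"
  by pat_completeness auto
termination
  by (relation "Wellfounded.measure (\<lambda>(l, f, c, N, w, t). Suc N - t)") auto

declare backward.simps [simp del]

definition H_at ::
  "(('x::finite, 'u::finite) xupoint \<Rightarrow> real) \<Rightarrow> (('x, 'u) xupoint \<Rightarrow> real^'x) \<Rightarrow>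
   (('x, 'u) xupoint \<Rightarrow> real^'c::finite) \<Rightarrow> nat \<Rightarrow> (nat \<Rightarrow> ('x, 'u, 'c) point) \<Rightarrow> nat \<Rightarrow> real^'u^'u"
where
  "H_at l f c N w t =
     (case backward l f c N w (Suc t) of (lam, V, P) \<Rightarrow> H_mat l f c (w t) lam P)"

definition gains_at ::
  "(('x::finite, 'u::finite) xupoint \<Rightarrow> real) \<Rightarrow> (('x, 'u) xupoint \<Rightarrow> real^'x) \<Rightarrow>
   (('x, 'u) xupoint \<Rightarrow> real^'c::finite) \<Rightarrow> nat \<Rightarrow> (nat \<Rightarrow> ('x, 'u, 'c) point) \<Rightarrow> nat \<Rightarrow>
   (real^'u) \<times> (real^'x^'u) \<times> (real^'c) \<times> (real^'x^'c)"
where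
  "gains_at l f c N w t = gains l f c (w t) (backward l f c N w (Suc t))"

text \<open>\<open>update_at l f c N w t x\<close> is the new point at time \<open>t\<close> when the new state is \<open>x\<close>.\<close>

definition update_at ::
  "(('x::finite, 'u::finite) xupoint \<Rightarrow> real) \<Rightarrow> (('x, 'u) xupoint \<Rightarrow> real^'x) \<Rightarrow>
   (('x, 'u) xupoint \<Rightarrow> real^'c::finite) \<Rightarrow> nat \<Rightarrow> (nat \<Rightarrow> ('x, 'u, 'c) point) \<Rightarrow> nat \<Rightarrow>
   real^'x \<Rightarrow> ('x, 'u, 'c) point"
where
  "update_at l f c N w t x =
     (case (w t, gains_at l f c N w t) of ((xbar, ubar, \<phi>bar), (\<alpha>, \<beta>, \<psi>, \<omega>)) \<Rightarrow>
        (x, ubar + \<alpha> + \<beta> *v (x - xbar), \<phi>bar + \<psi> + \<omega> *v (x - xbar)))"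

text \<open>Times start at 1; the value at time 0 is a dummy.\<close>

primrec forward_state ::
  "(('x::finite, 'u::finite) xupoint \<Rightarrow> real) \<Rightarrow> (('x, 'u) xupoint \<Rightarrow> real^'x) \<Rightarrow>
   (('x, 'u) xupoint \<Rightarrow> real^'c::finite) \<Rightarrow> nat \<Rightarrow> real^'x \<Rightarrow> (nat \<Rightarrow> ('x, 'u, 'c) point) \<Rightarrow>
   nat \<Rightarrow> real^'x"
where
  "forward_state l f c N x1 w 0 = x1"
| "forward_state l f c N x1 w (Suc t) =
     (if t = 0 then x1 else f (xu (update_at l f c N w t (forward_state l f c N x1 w t))))"

definition full_step ::
  "(('x::finite, 'u::finite) xupoint \<Rightarrow> real) \<Rightarrow> (('x, 'u) xupoint \<Rightarrow> real^'x) \<Rightarrow>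
   (('x, 'u) xupoint \<Rightarrow> real^'c::finite) \<Rightarrow> nat \<Rightarrow> real^'x \<Rightarrow> (nat \<Rightarrow> ('x, 'u, 'c) point) \<Rightarrow>
   nat \<Rightarrow> ('x, 'u, 'c) point"
where
  "full_step l f c N x1 w t = update_at l f c N w t (forward_state l f c N x1 w t)"

end

theory Submission
  imports Defs
begin

text \<open>
  Write \<open>\<delta> = w\<^sup>* - w\<close> for the distance of the current iterate to the optimal point and \<open>\<lambda>\<^sup>*\<close> for the
  optimal multipliers of the dynamics. Going backwards in time, the recursion keeps the invariant
  \<open>V\<^sub>t + P\<^sub>t \<delta>x\<^sub>t = \<lambda>\<^sup>*\<^sub>t + O(\<delta>\<^sup>2)\<close>, that is, the quadratic value model has the right gradient at the
  optimal state. Together with first-order Taylor expansions of the constraint, the dynamics and the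
  stationarity conditions, it shows that \<open>(\<delta>u, \<delta>\<phi>)\<close> solves the linear system for
  \<open>(\<alpha> + \<beta> \<delta>x, \<psi> + \<omega> \<delta>x)\<close> up to \<open>O(\<delta>\<^sup>2)\<close>; as the KKT matrix at the optimal point is non-singular,
  the two differ by \<open>O(\<delta>\<^sup>2)\<close>. The symmetry of \<open>H\<^sub>t\<close> and \<open>P\<^sub>t\<close> turns this into the invariant one stage
  earlier. Feasibility of the iterate for the dynamics enters in \<open>f(x\<^sup>*, u\<^sup>*) - f(x, u) = \<delta>x\<^sub>t\<^sub>+\<^sub>1\<close>.
  In the forward pass, each new point then inherits an error \<open>O(\<delta>\<^sup>2)\<close> from its predecessor.
\<close>

section \<open>Second-order calculus\<close>

text \<open>The backward pass carries two multiplier estimates, and they need different accuracy.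
  \<open>lam\<close> only weights second derivatives that get multiplied by a displacement, so a
  first-order error in it is harmless. \<open>V\<close> enters the residuals directly; it is itself
  only first-order accurate, and what is right to second order is its combination with
  \<open>P\<close> times the state displacement. The value of \<open>P\<close> is never compared
  with an ideal one: the same \<open>P\<close> occurs in the invariant and in \<open>H\<close>,
  \<open>B\<close>, \<open>C\<close>, so its contributions cancel. The obstacle is uniformity.
  Positivity on the null space is a pointwise condition and bounds no inverse uniformly, and the
  gains are picked by \<open>SOME\<close>, so no continuity comes for free. Hence the inverse is
  bounded at one matrix only, the one that the backward pass produces at the optimal point, and a
  perturbation argument carries the bound to nearby iterates. This is why the induction must also
  show that \<open>lam\<close>, \<open>V\<close> and \<open>P\<close> converge, at a linear rate, to
  their values in the backward pass at the optimal point.\<close>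

lemma taylor_lipschitz_derivative:
  fixes g :: "'a::real_normed_vector \<Rightarrow> 'b::real_normed_vector"
  assumes S: "convex S" "x \<in> S" "y \<in> S"
    and D: "\<And>z. z \<in> S \<Longrightarrow> (g has_derivative blinfun_apply (D z)) (at z)"
    and K: "K-lipschitz_on S D"
  shows "norm (g y - g x - D x (y - x)) \<le> K * (norm (y - x))\<^sup>2"
proof -
  have seg: "closed_segment x y \<subseteq> S"
    using S by (simp add: closed_segment_subset)
  \<comment> \<open>The mean value inequality is applied to the deviation from the linearisation at
    \<open>x\<close>. It gives \<open>K\<close> where integration would give half of it; only the
    order matters. The general codomain lets the lemma be applied to the derivative map
    \<open>D\<close> as well.\<close>
  have "norm (g y - g x - D x (y - x)) \<le> norm (y - x) * (K * norm (y - x))"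
  proof (rule differentiable_bound_linearization[where S = "closed_segment x y"])
    show "x + t *\<^sub>R (y - x) \<in> closed_segment x y" if "t \<in> {0..1}" for t
      using that by (auto simp: closed_segment_def algebra_simps intro!: exI[of _ t])
    show "(g has_derivative blinfun_apply (D z)) (at z within closed_segment x y)"
      if "z \<in> closed_segment x y" for z
      using D that seg by (blast intro: has_derivative_at_withinI)
    show "onorm (blinfun_apply (D z) - blinfun_apply (D x)) \<le> K * norm (y - x)"
      if z: "z \<in> closed_segment x y" for z
    proof -
      have "onorm (blinfun_apply (D z) - blinfun_apply (D x)) = norm (D z - D x)"
        by (simp add: norm_blinfun.rep_eq minus_blinfun.rep_eq fun_diff_def)
      also have "\<dots> \<le> K * norm (z - x)"
        using lipschitz_on_normD[OF K] z seg S by blast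
      also have "norm (z - x) \<le> norm (y - x)"
        using segment_bound1[OF z] by simp
      finally show ?thesis
        using lipschitz_on_nonneg[OF K] by (simp add: mult_left_mono)
    qed
    show "x \<in> closed_segment x y" by simp
  qed
  then show ?thesis by (simp add: power2_eq_square mult_ac)
qed

text \<open>The second difference is the increment over \<open>a\<close> of the function taking
  \<open>x\<close> to \<open>g (x + b) - g x\<close>. Subtracting the linear map
  \<open>D2 z b\<close> leaves a function \<open>h\<close> whose derivative at \<open>x\<close> is
  the Taylor remainder of \<open>D\<close> from \<open>x\<close> to \<open>x + b\<close> plus the
  change of \<open>D2\<close> from \<open>z\<close> to \<open>x\<close>. The resulting bound is
  cubic under joint scaling of \<open>a\<close> and \<open>b\<close>.\<close>

lemma second_difference_bound:
  fixes g :: "'a::real_normed_vector \<Rightarrow> 'b::real_normed_vector"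
  assumes S: "convex S" "z \<in> S" "z + a \<in> S" "z + b \<in> S" "z + a + b \<in> S"
    and D: "\<And>z. z \<in> S \<Longrightarrow> (g has_derivative blinfun_apply (D z)) (at z)"
    and D2: "\<And>z. z \<in> S \<Longrightarrow> (D has_derivative blinfun_apply (D2 z)) (at z)"
    and K: "K-lipschitz_on S D2"
  shows "norm (g (z + a + b) - g (z + a) - g (z + b) + g z - D2 z b a)
           \<le> norm a * (K * (norm b)\<^sup>2 + K * norm a * norm b)"
proof -
  have K0: "0 \<le> K"
    using K by (rule lipschitz_on_nonneg)
  define h where "h x = g (x + b) - g x - D2 z b x" for x
  have segS: "x \<in> S \<and> x + b \<in> S" and segn: "norm (x - z) \<le> norm a" if x: "x \<in> closed_segment z (z + a)" for x
  proof -
    obtain u where u: "0 \<le> u" "u \<le> 1" "x = (1 - u) *\<^sub>R z + u *\<^sub>R (z + a)"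
      using x by (auto simp: in_segment)
    have "x + b = (1 - u) *\<^sub>R (z + b) + u *\<^sub>R (z + a + b)"
      by (simp add: u algebra_simps)
    then show "x \<in> S \<and> x + b \<in> S"
      using u S convexD[OF \<open>convex S\<close>, of z "z + a" "1 - u" u]
        convexD[OF \<open>convex S\<close>, of "z + b" "z + a + b" "1 - u" u] by simp
    show "norm (x - z) \<le> norm a"
      using segment_bound1[OF that] by simp
  qed
  have "norm (h (z + a) - h z) \<le> (K * (norm b)\<^sup>2 + K * norm a * norm b) * norm ((z + a) - z)"
  proof (rule differentiable_bound[where S = "closed_segment z (z + a)"
        and f' = "\<lambda>x. blinfun_apply (D (x + b) - D x - D2 z b)"])
    fix x assume x: "x \<in> closed_segment z (z + a)"
    have "(g has_derivative blinfun_apply (D (x + b))) (at (x + b))"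
      using D segS[OF x] by simp
    then have "((\<lambda>x. g (x + b)) has_derivative blinfun_apply (D (x + b))) (at x)"
      using diff_chain_at[OF has_derivative_add_const[OF has_derivative_ident], where x = x and g = g]
      by (auto simp: o_def)
    moreover have "(g has_derivative blinfun_apply (D x)) (at x)"
      using D segS[OF x] by simp
    ultimately have "(h has_derivative blinfun_apply (D (x + b) - D x - D2 z b)) (at x)"
      unfolding h_def by (auto intro!: derivative_eq_intros simp: blinfun.diff_left)
    then show "(h has_derivative blinfun_apply (D (x + b) - D x - D2 z b)) (at x within closed_segment z (z + a))"
      by (rule has_derivative_at_withinI)
    have n1: "norm (D (x + b) - D x - D2 x b) \<le> K * (norm b)\<^sup>2"
      using taylor_lipschitz_derivative[OF S(1) _ _ D2 K, of x "x + b"] segS[OF x] by simp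
    have n2: "norm ((D2 x - D2 z) b) \<le> K * norm a * norm b"
    proof -
      have "norm ((D2 x - D2 z) b) \<le> norm (D2 x - D2 z) * norm b"
        by (rule norm_blinfun)
      also have "norm (D2 x - D2 z) \<le> K * norm (x - z)"
        using lipschitz_on_normD[OF K, of x z] segS[OF x] S by simp
      also have "\<dots> \<le> K * norm a"
        using K0 segn[OF x] by (simp add: mult_left_mono)
      finally show ?thesis by (simp add: mult_right_mono)
    qed
    have eq: "D (x + b) - D x - D2 z b = (D (x + b) - D x - D2 x b) + (D2 x - D2 z) b"
      by (simp add: blinfun.diff_left)
    have "norm (D (x + b) - D x - D2 z b) \<le> K * (norm b)\<^sup>2 + K * norm a * norm b"
      unfolding eq using n1 n2 by (rule norm_triangle_mono)
    then show "onorm (blinfun_apply (D (x + b) - D x - D2 z b)) \<le> K * (norm b)\<^sup>2 + K * norm a * norm b"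
      by (simp add: norm_blinfun.rep_eq)
  qed simp_all
  moreover have "h (z + a) - h z = g (z + a + b) - g (z + a) - g (z + b) + g z - D2 z b a"
    by (simp add: h_def blinfun.add_right algebra_simps)
  ultimately show ?thesis by (simp add: mult.commute)
qed

text \<open>The second difference does not change when \<open>a\<close> and \<open>b\<close> are
  swapped, so it is approximated by both \<open>D2 z b a\<close> and \<open>D2 z a b\<close>. With
  both directions scaled by \<open>s\<close> the errors are cubic in \<open>s\<close> while the two
  values scale with the square of \<open>s\<close>; division and \<open>s\<close> tending to 0 give
  equality.\<close>

lemma second_derivative_symmetric:
  fixes g :: "'a::real_normed_vector \<Rightarrow> 'b::real_normed_vector"
  assumes S: "open S" "z \<in> S"
    and D: "\<And>z. z \<in> S \<Longrightarrow> (g has_derivative blinfun_apply (D z)) (at z)"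
    and D2: "\<And>z. z \<in> S \<Longrightarrow> (D has_derivative blinfun_apply (D2 z)) (at z)"
    and K: "K-lipschitz_on S D2"
  shows "D2 z a b = D2 z b a"
proof -
  obtain r where r: "0 < r" "ball z r \<subseteq> S"
    using S openE by blast
  define m where "m = norm a + norm b"
  \<comment> \<open>The sum of the two bounds of \<open>second_difference_bound\<close> for the
    unscaled directions.\<close>
  define C where "C = norm a * (K * (norm b)\<^sup>2 + K * norm a * norm b)
    + norm b * (K * (norm a)\<^sup>2 + K * norm b * norm a)"
  have m0: "0 \<le> m" by (simp add: m_def)
  have bnd: "norm (D2 z a b - D2 z b a) \<le> C * s" if s: "0 < s" "s * m < r" for s
  proof -
    have n: "norm (s *\<^sub>R a) < r" "norm (s *\<^sub>R b) < r" "norm (s *\<^sub>R a + s *\<^sub>R b) < r"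
    proof -
      have "norm (s *\<^sub>R a) + norm (s *\<^sub>R b) = s * m"
        using s by (simp add: m_def algebra_simps)
      then show "norm (s *\<^sub>R a) < r" "norm (s *\<^sub>R b) < r" "norm (s *\<^sub>R a + s *\<^sub>R b) < r"
        using s norm_triangle_ineq[of "s *\<^sub>R a" "s *\<^sub>R b"] norm_ge_zero[of "s *\<^sub>R a"] norm_ge_zero[of "s *\<^sub>R b"]
        by linarith+
    qed
    have inb: "z \<in> ball z r" "z + s *\<^sub>R a \<in> ball z r" "z + s *\<^sub>R b \<in> ball z r"
        "z + s *\<^sub>R a + s *\<^sub>R b \<in> ball z r" "z + s *\<^sub>R b + s *\<^sub>R a \<in> ball z r"
      using n r by (auto simp: dist_norm norm_minus_commute add.assoc algebra_simps)
    have KB: "K-lipschitz_on (ball z r) D2"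
      using K r(2) by (rule lipschitz_on_subset)
    have DB: "(g has_derivative blinfun_apply (D y)) (at y)"
      and D2B: "(D has_derivative blinfun_apply (D2 y)) (at y)" if "y \<in> ball z r" for y
      using that r D D2 by blast+
    let ?X = "g (z + s *\<^sub>R a + s *\<^sub>R b) - g (z + s *\<^sub>R a) - g (z + s *\<^sub>R b) + g z"
    have "norm (?X - D2 z (s *\<^sub>R b) (s *\<^sub>R a))
        \<le> norm (s *\<^sub>R a) * (K * (norm (s *\<^sub>R b))\<^sup>2 + K * norm (s *\<^sub>R a) * norm (s *\<^sub>R b))"
      using second_difference_bound[OF _ inb(1,2,3,4) DB D2B KB] by simp
    moreover have "norm (g (z + s *\<^sub>R b + s *\<^sub>R a) - g (z + s *\<^sub>R b) - g (z + s *\<^sub>R a) + g z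
          - D2 z (s *\<^sub>R a) (s *\<^sub>R b))
        \<le> norm (s *\<^sub>R b) * (K * (norm (s *\<^sub>R a))\<^sup>2 + K * norm (s *\<^sub>R b) * norm (s *\<^sub>R a))"
      using second_difference_bound[OF _ inb(1,3,2,5) DB D2B KB] by simp
    moreover have "g (z + s *\<^sub>R b + s *\<^sub>R a) - g (z + s *\<^sub>R b) - g (z + s *\<^sub>R a) + g z = ?X"
      by (simp add: algebra_simps)
    ultimately have "norm (D2 z (s *\<^sub>R a) (s *\<^sub>R b) - D2 z (s *\<^sub>R b) (s *\<^sub>R a))
        \<le> norm (s *\<^sub>R a) * (K * (norm (s *\<^sub>R b))\<^sup>2 + K * norm (s *\<^sub>R a) * norm (s *\<^sub>R b))
         + norm (s *\<^sub>R b) * (K * (norm (s *\<^sub>R a))\<^sup>2 + K * norm (s *\<^sub>R b) * norm (s *\<^sub>R a))"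
      using norm_triangle_ineq4[of "?X - D2 z (s *\<^sub>R b) (s *\<^sub>R a)" "?X - D2 z (s *\<^sub>R a) (s *\<^sub>R b)"]
      by simp
    also have "\<dots> = s\<^sup>2 * (C * s)"
      using s by (simp add: C_def power2_eq_square algebra_simps)
    also have "D2 z (s *\<^sub>R a) (s *\<^sub>R b) - D2 z (s *\<^sub>R b) (s *\<^sub>R a) = s\<^sup>2 *\<^sub>R (D2 z a b - D2 z b a)"
      by (simp add: blinfun.scaleR_right blinfun.scaleR_left power2_eq_square scaleR_diff_right)
    finally have "s\<^sup>2 * norm (D2 z a b - D2 z b a) \<le> s\<^sup>2 * (C * s)"
      by simp
    then show ?thesis using s by simp
  qed
  have "((\<lambda>s. C * s) \<longlongrightarrow> C * 0) (at_right 0)"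
    by (intro tendsto_intros)
  moreover have "((\<lambda>s. s * m) \<longlongrightarrow> 0 * m) (at_right 0)"
    by (intro tendsto_intros)
  then have "\<forall>\<^sub>F s in at_right 0. s * m < r"
    using r by (intro order_tendstoD(2)) auto
  then have "\<forall>\<^sub>F s in at_right 0. norm (D2 z a b - D2 z b a) \<le> C * s"
    using eventually_at_right_less[of "0::real"] by eventually_elim (rule bnd)
  ultimately have "norm (D2 z a b - D2 z b a) \<le> C * 0"
    by (intro tendsto_lowerbound) auto
  then show ?thesis by simp
qed

section \<open>Asymptotic orders\<close>

text \<open>\<open>F\<close> will be the filter of admissible iterates approaching the optimal point
  and \<open>e\<close> the distance to it. Arguing along a filter absorbs the radii and constants of
  the finitely many stages; one radius and one constant are extracted only at the very end.\<close>

locale small_error =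
  fixes F :: "'w filter" and e :: "'w \<Rightarrow> real"
  assumes e_nonneg: "0 \<le> e w"
    and e_tendsto: "(e \<longlongrightarrow> 0) F"
begin

definition ord :: "nat \<Rightarrow> ('w \<Rightarrow> 'b::real_normed_vector) \<Rightarrow> bool" where
  "ord k g \<longleftrightarrow> (\<exists>M. \<forall>\<^sub>F w in F. norm (g w) \<le> M * e w ^ k)"

text \<open>A linear rate is demanded instead of mere convergence because such a deviation times a
  displacement then has order 2.\<close>

definition near :: "('w \<Rightarrow> 'b::real_normed_vector) \<Rightarrow> 'b \<Rightarrow> bool" where
  "near g g0 \<longleftrightarrow> ord 1 (\<lambda>w. g w - g0)"

lemma ordI: "\<forall>\<^sub>F w in F. norm (g w) \<le> M * e w ^ k \<Longrightarrow> ord k g"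
  unfolding ord_def by blast

lemma ordE:
  assumes "ord k g"
  obtains M where "M > 0" "\<forall>\<^sub>F w in F. norm (g w) \<le> M * e w ^ k"
proof -
  obtain M where M: "\<forall>\<^sub>F w in F. norm (g w) \<le> M * e w ^ k"
    using assms unfolding ord_def by blast
  have "\<forall>\<^sub>F w in F. norm (g w) \<le> (\<bar>M\<bar> + 1) * e w ^ k"
    using M
  proof eventually_elim
    case (elim w)
    also have "M * e w ^ k \<le> (\<bar>M\<bar> + 1) * e w ^ k"
      using e_nonneg by (intro mult_right_mono) auto
    finally show ?case .
  qed
  then show ?thesis by (intro that[of "\<bar>M\<bar> + 1"]) auto
qed

lemma eventually_e_less: "r > 0 \<Longrightarrow> \<forall>\<^sub>F w in F. e w < r"
  using e_tendsto by (rule order_tendstoD)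

lemma ord_le:
  assumes "ord k h" and "\<forall>\<^sub>F w in F. norm (g w) \<le> C * norm (h w)" and "0 \<le> C"
  shows "ord k g"
proof -
  obtain M where "\<forall>\<^sub>F w in F. norm (h w) \<le> M * e w ^ k"
    by (rule ordE[OF assms(1)])
  then have "\<forall>\<^sub>F w in F. norm (g w) \<le> (C * M) * e w ^ k"
    using assms(2)
  proof eventually_elim
    case (elim w)
    then show ?case using \<open>0 \<le> C\<close> mult_left_mono[OF elim(1) \<open>0 \<le> C\<close>] by (simp add: mult.assoc)
  qed
  then show ?thesis by (rule ordI)
qed

lemma ord_cong:
  assumes "ord k h" and "\<forall>\<^sub>F w in F. g w = h w"
  shows "ord k g"
  using assms(1) by (rule ord_le[where C = 1]) (use assms(2) in \<open>auto elim!: eventually_mono\<close>)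

lemma ord_mono:
  assumes "ord k g" and "j \<le> k"
  shows "ord j g"
proof -
  obtain M where M: "M > 0" "\<forall>\<^sub>F w in F. norm (g w) \<le> M * e w ^ k"
    by (rule ordE[OF assms(1)])
  have "\<forall>\<^sub>F w in F. norm (g w) \<le> M * e w ^ j"
    using M(2) eventually_e_less[of 1, simplified]
  proof eventually_elim
    case (elim w)
    have "e w ^ k \<le> e w ^ j"
      using elim(2) e_nonneg assms by (intro power_decreasing) auto
    with elim M show ?case by (meson mult_left_mono less_imp_le order_trans)
  qed
  then show ?thesis by (rule ordI)
qed

lemma ord_zero [simp]: "ord k (\<lambda>w. 0)"
  by (rule ordI[where M = 0]) auto

lemma ord_const: "ord 0 (\<lambda>w. a)"
  by (rule ordI[where M = "norm a"]) auto

lemma ord_add: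
  assumes "ord k g" and "ord k h"
  shows "ord k (\<lambda>w. g w + h w)"
proof -
  obtain M where M: "\<forall>\<^sub>F w in F. norm (g w) \<le> M * e w ^ k"
    by (rule ordE[OF assms(1)])
  obtain M' where M': "\<forall>\<^sub>F w in F. norm (h w) \<le> M' * e w ^ k"
    by (rule ordE[OF assms(2)])
  have "\<forall>\<^sub>F w in F. norm (g w + h w) \<le> (M + M') * e w ^ k"
    using M M' by eventually_elim (simp add: distrib_right norm_triangle_mono)
  then show ?thesis by (rule ordI)
qed

lemma ord_linear:
  assumes "bounded_linear T" and "ord k g"
  shows "ord k (\<lambda>w. T (g w))"
proof -
  obtain K where K: "K \<ge> 0" "\<And>x. norm (T x) \<le> norm x * K"
    using bounded_linear.nonneg_bounded[OF assms(1)] by metis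
  show ?thesis
    by (rule ord_le[OF assms(2) _ K(1)]) (use K(2) in \<open>simp add: mult.commute\<close>)
qed

lemma ord_minus: "ord k g \<Longrightarrow> ord k (\<lambda>w. - g w)"
  by (rule ord_linear[OF bounded_linear_minus[OF bounded_linear_ident]])

lemma ord_diff: "ord k g \<Longrightarrow> ord k h \<Longrightarrow> ord k (\<lambda>w. g w - h w)"
  using ord_add[OF _ ord_minus, of k g h] by simp

lemma ord_sum: "(\<And>i. i \<in> I \<Longrightarrow> ord k (g i)) \<Longrightarrow> ord k (\<lambda>w. \<Sum>i\<in>I. g i w)"
  by (induction I rule: infinite_finite_induct) (auto intro: ord_add)

lemma ord_norm: "ord k g \<Longrightarrow> ord k (\<lambda>w. norm (g w))"
  by (erule ord_le[where C = 1]) simp_all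

lemma ord_Pair:
  assumes "ord k g" and "ord k h"
  shows "ord k (\<lambda>w. (g w, h w))"
proof -
  have "ord k (\<lambda>w. (g w, 0) + (0, h w))"
    by (rule ord_add[OF ord_linear[OF bounded_linear_Pair[OF bounded_linear_ident bounded_linear_zero] assms(1)]
          ord_linear[OF bounded_linear_Pair[OF bounded_linear_zero bounded_linear_ident] assms(2)]])
  then show ?thesis by simp
qed

lemma ord_bilinear:
  assumes "bounded_bilinear B" and "ord i g" and "ord j h"
  shows "ord (i + j) (\<lambda>w. B (g w) (h w))"
proof -
  obtain K where K: "K \<ge> 0" "\<And>x y. norm (B x y) \<le> norm x * norm y * K"
    using bounded_bilinear.nonneg_bounded[OF assms(1)] by metis
  obtain M where M: "M > 0" "\<forall>\<^sub>F w in F. norm (g w) \<le> M * e w ^ i"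
    by (rule ordE[OF assms(2)])
  obtain M' where M': "M' > 0" "\<forall>\<^sub>F w in F. norm (h w) \<le> M' * e w ^ j"
    by (rule ordE[OF assms(3)])
  have "\<forall>\<^sub>F w in F. norm (B (g w) (h w)) \<le> (M * M' * K) * e w ^ (i + j)"
    using M(2) M'(2)
  proof eventually_elim
    case (elim w)
    have "norm (g w) * norm (h w) \<le> (M * e w ^ i) * (M' * e w ^ j)"
      using elim M(1) M'(1) e_nonneg[of w] by (intro mult_mono) (simp_all add: order_trans[OF norm_ge_zero])
    then have "norm (g w) * norm (h w) * K \<le> (M * e w ^ i) * (M' * e w ^ j) * K"
      using K(1) by (rule mult_right_mono)
    with K(2)[of "g w" "h w"] show ?case by (simp add: power_add mult_ac)
  qed
  then show ?thesis by (rule ordI)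
qed

lemma ord_bilinear':
  assumes "bounded_bilinear B" and "ord i g" and "ord j h" and "k = i + j"
  shows "ord k (\<lambda>w. B (g w) (h w))"
  using ord_bilinear[OF assms(1-3)] assms(4) by simp

lemma ord_vecI:
  fixes g :: "'w \<Rightarrow> real^'n"
  assumes "\<And>i. ord k (\<lambda>w. g w $ i)"
  shows "ord k g"
proof -
  have "ord k (\<lambda>w. \<Sum>i\<in>UNIV. g w $ i *\<^sub>R axis i (1::real))"
    by (rule ord_sum, rule ord_linear[OF bounded_linear_scaleR_left assms])
  moreover have "(\<Sum>i\<in>UNIV. g w $ i *\<^sub>R axis i 1) = g w" for w
    using basis_expansion[of "g w"] by (simp add: scalar_mult_eq_scaleR)
  ultimately show ?thesis by simp
qed

lemma ord_matI:
  fixes g :: "'w \<Rightarrow> real^'n^'m"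
  assumes "\<And>j. ord k (\<lambda>w. g w *v axis j 1)"
  shows "ord k g"
proof -
  \<comment> \<open>\<open>T j v\<close> has column \<open>j\<close> equal to \<open>v\<close> and
    zeros elsewhere, so a matrix is the sum of the images of its columns.\<close>
  define T :: "'n \<Rightarrow> real^'m \<Rightarrow> real^'n^'m" where "T j v = (\<chi> i k. v $ i * axis j 1 $ k)" for j v
  have "linear (T j)" for j
    by (auto simp: linear_iff T_def vec_eq_iff algebra_simps)
  then have T: "bounded_linear (T j)" for j
    by (simp add: linear_conv_bounded_linear)
  have "ord k (\<lambda>w. \<Sum>j\<in>UNIV. T j (g w *v axis j 1))"
    by (rule ord_sum, rule ord_linear[OF T assms])
  moreover have "(\<Sum>j\<in>UNIV. T j (g w *v axis j 1)) = g w" for w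
    unfolding T_def matrix_vector_mult_basis vec_eq_iff
    by (simp add: column_def axis_def if_distrib[of "\<lambda>x. _ * x"] cong: if_cong)
  ultimately show ?thesis by simp
qed

lemma near_const [simp]: "near (\<lambda>w. a) a"
  by (simp add: near_def)

lemma near_cong: "near h a \<Longrightarrow> \<forall>\<^sub>F w in F. g w = h w \<Longrightarrow> near g a"
  unfolding near_def by (erule ord_cong, erule eventually_mono) simp

lemma near_ord0: "near g a \<Longrightarrow> ord 0 g"
  using ord_add[OF ord_mono ord_const, of 1 "\<lambda>w. g w - a" a] by (simp add: near_def)

lemma near_add: "near g a \<Longrightarrow> near h b \<Longrightarrow> near (\<lambda>w. g w + h w) (a + b)"
  unfolding near_def by (drule (1) ord_add) (simp add: algebra_simps)

lemma near_linear:
  assumes "bounded_linear T" and "near g a"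
  shows "near (\<lambda>w. T (g w)) (T a)"
  using ord_linear[OF assms(1) assms(2)[unfolded near_def]] unfolding near_def
  by (simp add: linear_diff[OF bounded_linear.linear[OF assms(1)]])

lemma near_bilinear:
  assumes "bounded_bilinear B" and "near g a" and "near h b"
  shows "near (\<lambda>w. B (g w) (h w)) (B a b)"
proof -
  interpret bounded_bilinear B by fact
  have "ord (1 + 0) (\<lambda>w. B (g w - a) (h w))"
    by (rule ord_bilinear[OF assms(1) assms(2)[unfolded near_def] near_ord0[OF assms(3)]])
  moreover have "ord (0 + 1) (\<lambda>w. B a (h w - b))"
    by (rule ord_bilinear[OF assms(1) ord_const assms(3)[unfolded near_def]])
  ultimately have "ord 1 (\<lambda>w. B (g w - a) (h w) + B a (h w - b))"
    using ord_add[of 1 "\<lambda>w. B (g w - a) (h w)" "\<lambda>w. B a (h w - b)"] by simp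
  then show ?thesis
    unfolding near_def by (simp add: diff_left diff_right)
qed

lemma near_vecI:
  fixes g :: "'w \<Rightarrow> real^'n"
  assumes "\<And>i. near (\<lambda>w. g w $ i) (a $ i)"
  shows "near g a"
  using assms unfolding near_def by (auto intro!: ord_vecI)

lemma near_matI:
  fixes g :: "'w \<Rightarrow> real^'n^'m"
  assumes "\<And>j. near (\<lambda>w. g w *v axis j 1) (a *v axis j 1)"
  shows "near g a"
  using assms unfolding near_def by (intro ord_matI) (simp add: matrix_vector_mult_diff_rdistrib)

end

section \<open>Continuity of the matrix operations\<close>

lemma bounded_bilinear_matrix_mul: "bounded_bilinear ((**) :: real^'n^'m \<Rightarrow> real^'p^'n \<Rightarrow> real^'p^'m)"
  unfolding bilinear_conv_bounded_bilinear[symmetric] bilinear_def linear_iff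
  by (auto simp: matrix_matrix_mult_def vec_eq_iff sum.distrib sum_distrib_left algebra_simps)

lemma bounded_bilinear_matrix_vector_mul: "bounded_bilinear ((*v) :: real^'n^'m \<Rightarrow> real^'n \<Rightarrow> real^'m)"
  unfolding bilinear_conv_bounded_bilinear[symmetric] bilinear_def linear_iff
  by (auto simp: matrix_vector_mult_def vec_eq_iff sum.distrib sum_distrib_left algebra_simps)

lemma bounded_bilinear_vector_matrix_mul: "bounded_bilinear ((v*) :: real^'m \<Rightarrow> real^'n^'m \<Rightarrow> real^'n)"
  unfolding bilinear_conv_bounded_bilinear[symmetric] bilinear_def linear_iff
  by (auto simp: vector_matrix_mult_def vec_eq_iff sum.distrib sum_distrib_left algebra_simps)

lemma bounded_linear_transpose: "bounded_linear (transpose :: real^'n^'m \<Rightarrow> real^'m^'n)"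
  unfolding linear_conv_bounded_linear[symmetric] linear_iff
  by (auto simp: transpose_def vec_eq_iff)

section \<open>KKT systems\<close>

text \<open>The block matrix \<open>K\<close> as a linear map on pairs, which avoids matrices
  indexed by a sum type.\<close>

definition kkt_map :: "real^'u^'u \<Rightarrow> real^'c^'u \<Rightarrow> (real^'u) \<times> (real^'c) \<Rightarrow> (real^'u) \<times> (real^'c)" where
  "kkt_map H A v = (H *v fst v + A *v snd v, transpose A *v fst v)"

lemma linear_kkt_map: "linear (kkt_map H A)"
  unfolding linear_iff kkt_map_def
  by (auto simp: algebra_simps scaleR_matrix_vector_assoc simp del: transpose_matrix_vector)

lemma inj_kkt_map:
  assumes "\<And>\<xi> \<eta>. H *v \<xi> + A *v \<eta> = 0 \<Longrightarrow> transpose A *v \<xi> = 0 \<Longrightarrow> \<xi> = 0 \<and> \<eta> = 0"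
  shows "inj (kkt_map H A)"
proof (rule linear_injective_0[THEN iffD2, OF linear_kkt_map], intro allI impI)
  fix v assume "kkt_map H A v = 0"
  then show "v = 0"
    using assms[of "fst v" "snd v"]
    by (simp add: kkt_map_def zero_prod_def prod_eq_iff del: transpose_matrix_vector)
qed

lemma kkt_surj:
  fixes H :: "real^'u^'u" and A :: "real^'c^'u"
  assumes "\<And>\<xi> \<eta>. H *v \<xi> + A *v \<eta> = 0 \<Longrightarrow> transpose A *v \<xi> = 0 \<Longrightarrow> \<xi> = 0 \<and> \<eta> = 0"
  obtains \<xi> \<eta> where "H *v \<xi> + A *v \<eta> = a" "transpose A *v \<xi> = b"
proof -
  have "surj (kkt_map H A)"
    using linear_kkt_map[of H A] inj_kkt_map[OF assms] by (simp add: linear_injective_imp_surjective)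
  then obtain v where "kkt_map H A v = (a, b)" by (metis surjD)
  then show ?thesis by (intro that[of "fst v" "snd v"]) (auto simp: kkt_map_def)
qed

context small_error
begin

text \<open>The injective limit map is bounded below by some \<open>b > 0\<close>. The perturbed map
  differs from it by an operator of size \<open>s w\<close>, which tends to 0 and so drops below
  \<open>b / 2\<close>. The perturbed map is then bounded below by \<open>b / 2\<close>, and a pair
  is at most \<open>2 / b\<close> times its residual.\<close>

lemma ord_kkt:
  fixes H :: "'w \<Rightarrow> real^'u^'u" and A :: "'w \<Rightarrow> real^'c^'u"
  assumes H: "near H H0" and A: "near A A0"
    and inj: "\<And>\<xi> \<eta>. H0 *v \<xi> + A0 *v \<eta> = 0 \<Longrightarrow> transpose A0 *v \<xi> = 0 \<Longrightarrow> \<xi> = 0 \<and> \<eta> = 0"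
    and r1: "ord k (\<lambda>w. H w *v \<xi> w + A w *v \<eta> w)" and r2: "ord k (\<lambda>w. transpose (A w) *v \<xi> w)"
  shows "ord k \<xi>" and "ord k \<eta>"
proof -
  obtain b where b: "b > 0" "\<And>v. b * norm v \<le> norm (kkt_map H0 A0 v)"
    using linear_inj_bounded_below_pos[OF linear_kkt_map inj_kkt_map[OF inj]] by blast
  obtain K1 where K1: "K1 \<ge> 0" "\<And>(M::real^'u^'u) x. norm (M *v x) \<le> norm M * norm x * K1"
    using bounded_bilinear.nonneg_bounded[OF bounded_bilinear_matrix_vector_mul] by metis
  obtain K2 where K2: "K2 \<ge> 0" "\<And>(M::real^'c^'u) x. norm (M *v x) \<le> norm M * norm x * K2"
    using bounded_bilinear.nonneg_bounded[OF bounded_bilinear_matrix_vector_mul] by metis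
  obtain K3 where K3: "K3 \<ge> 0" "\<And>(M::real^'c^'u) x. norm (transpose M *v x) \<le> norm M * norm x * K3"
    using bounded_bilinear.nonneg_bounded[OF bounded_bilinear_vector_matrix_mul]
    by (metis (no_types) mult.commute transpose_matrix_vector)
  have Tdiff: "norm (kkt_map H A v - kkt_map H0 A0 v) \<le> (norm (H - H0) * K1 + norm (A - A0) * (K2 + K3)) * norm v" for H A v
  proof -
    have 1: "norm ((H - H0) *v fst v) \<le> norm (H - H0) * norm v * K1"
      using K1(2)[of "H - H0" "fst v"] K1(1) norm_fst_le[of "fst v" "snd v"]
      by (smt (verit) mult_left_mono mult_right_mono norm_ge_zero prod.collapse)
    have 2: "norm ((A - A0) *v snd v) \<le> norm (A - A0) * norm v * K2"
      using K2(2)[of "A - A0" "snd v"] K2(1) norm_snd_le[of "snd v" "fst v"]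
      by (smt (verit) mult_left_mono mult_right_mono norm_ge_zero prod.collapse)
    have 3: "norm (transpose (A - A0) *v fst v) \<le> norm (A - A0) * norm v * K3"
      using K3(2)[of "A - A0" "fst v"] K3(1) norm_fst_le[of "fst v" "snd v"]
      by (smt (verit) mult_left_mono mult_right_mono norm_ge_zero prod.collapse)
    have "kkt_map H A v - kkt_map H0 A0 v = ((H - H0) *v fst v + (A - A0) *v snd v, transpose (A - A0) *v fst v)"
      by (simp add: kkt_map_def algebra_simps)
    also have "norm \<dots> \<le> norm ((H - H0) *v fst v + (A - A0) *v snd v) + norm (transpose (A - A0) *v fst v)"
      by (rule norm_Pair_le)
    also have "\<dots> \<le> norm ((H - H0) *v fst v) + norm ((A - A0) *v snd v) + norm (transpose (A - A0) *v fst v)"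
      by (intro add_right_mono norm_triangle_ineq)
    finally show ?thesis using 1 2 3 by (simp add: algebra_simps)
  qed
  obtain M1 where M1: "\<forall>\<^sub>F w in F. norm (H w - H0) \<le> M1 * e w ^ 1"
    by (rule ordE[OF H[unfolded near_def]])
  obtain M2 where M2: "\<forall>\<^sub>F w in F. norm (A w - A0) \<le> M2 * e w ^ 1"
    by (rule ordE[OF A[unfolded near_def]])
  define s where "s w = (M1 * e w) * K1 + (M2 * e w) * (K2 + K3)" for w
  have "(s \<longlongrightarrow> (M1 * 0) * K1 + (M2 * 0) * (K2 + K3)) F"
    unfolding s_def by (intro tendsto_intros e_tendsto)
  then have "\<forall>\<^sub>F w in F. s w < b / 2"
    using b(1) by (intro order_tendstoD(2)) auto
  then have ev: "\<forall>\<^sub>F w in F. norm (\<xi> w, \<eta> w) \<le> (2 / b) * norm (kkt_map (H w) (A w) (\<xi> w, \<eta> w))"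
    using M1 M2
  proof eventually_elim
    case (elim w)
    let ?v = "(\<xi> w, \<eta> w)"
    have "norm (H w - H0) * K1 + norm (A w - A0) * (K2 + K3) \<le> s w"
      unfolding s_def using elim K1(1) K2(1) K3(1) by (intro add_mono mult_right_mono) auto
    then have "norm (kkt_map (H w) (A w) ?v - kkt_map H0 A0 ?v) \<le> b / 2 * norm ?v"
      using Tdiff[of "H w" "A w" ?v] elim(1) by (smt (verit) mult_right_mono norm_ge_zero)
    moreover have "b * norm ?v \<le> norm (kkt_map H0 A0 ?v)"
      by (rule b(2))
    ultimately have "b / 2 * norm ?v \<le> norm (kkt_map (H w) (A w) ?v)"
      using norm_triangle_ineq2[of "kkt_map H0 A0 ?v" "kkt_map (H w) (A w) ?v"]
      by (simp add: norm_minus_commute)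
    then show ?case using b(1) by (simp add: field_simps)
  qed
  have T: "ord k (\<lambda>w. kkt_map (H w) (A w) (\<xi> w, \<eta> w))"
    using ord_Pair[OF r1 r2] by (simp add: kkt_map_def)
  have "ord k (\<lambda>w. (\<xi> w, \<eta> w))"
    by (rule ord_le[OF T ev]) (use b(1) in simp)
  then show "ord k \<xi>" "ord k \<eta>"
    using ord_linear[OF bounded_linear_fst] ord_linear[OF bounded_linear_snd] by fastforce+
qed

text \<open>The difference to the limit solution satisfies the perturbed system with a first-order
  right-hand side: the change of the data minus the change of the coefficients applied to the fixed
  vectors \<open>\<xi>0\<close>, \<open>\<eta>0\<close>. So \<open>ord_kkt\<close> applies to
  it.\<close>

lemma near_kkt:
  fixes H :: "'w \<Rightarrow> real^'u^'u" and A :: "'w \<Rightarrow> real^'c^'u"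
  assumes H: "near H H0" and A: "near A A0"
    and inj: "\<And>\<xi> \<eta>. H0 *v \<xi> + A0 *v \<eta> = 0 \<Longrightarrow> transpose A0 *v \<xi> = 0 \<Longrightarrow> \<xi> = 0 \<and> \<eta> = 0"
    and r1: "near r1 a" "\<forall>\<^sub>F w in F. H w *v \<xi> w + A w *v \<eta> w = r1 w" "H0 *v \<xi>0 + A0 *v \<eta>0 = a"
    and r2: "near r2 b" "\<forall>\<^sub>F w in F. transpose (A w) *v \<xi> w = r2 w" "transpose A0 *v \<xi>0 = b"
  shows "near \<xi> \<xi>0" and "near \<eta> \<eta>0"
proof -
  have n1: "near (\<lambda>w. H w *v \<xi>0 + A w *v \<eta>0) (H0 *v \<xi>0 + A0 *v \<eta>0)"
    by (intro near_add near_bilinear[OF bounded_bilinear_matrix_vector_mul] H A near_const)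
  have n2: "near (\<lambda>w. transpose (A w) *v \<xi>0) (transpose A0 *v \<xi>0)"
    by (intro near_bilinear[OF bounded_bilinear_matrix_vector_mul]
        near_linear[OF bounded_linear_transpose] A near_const)
  have "ord 1 (\<lambda>w. (r1 w - a) - (H w *v \<xi>0 + A w *v \<eta>0 - a))"
    by (rule ord_diff[OF r1(1)[unfolded near_def] n1[unfolded near_def r1(3)]])
  then have "ord 1 (\<lambda>w. H w *v (\<xi> w - \<xi>0) + A w *v (\<eta> w - \<eta>0))"
    by (rule ord_cong) (use r1(2) in \<open>auto elim!: eventually_mono simp: algebra_simps\<close>)
  moreover
  have "ord 1 (\<lambda>w. (r2 w - b) - (transpose (A w) *v \<xi>0 - b))"
    by (rule ord_diff[OF r2(1)[unfolded near_def] n2[unfolded near_def r2(3)]])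
  then have "ord 1 (\<lambda>w. transpose (A w) *v (\<xi> w - \<xi>0))"
    by (rule ord_cong) (use r2(2) in \<open>auto elim!: eventually_mono simp: algebra_simps\<close>)
  ultimately show "near \<xi> \<xi>0" "near \<eta> \<eta>0"
    unfolding near_def using ord_kkt[OF H A inj, of 1 "\<lambda>w. \<xi> w - \<xi>0" "\<lambda>w. \<eta> w - \<eta>0"] by auto
qed

end

lemma matrix_eq_columns: "M = M' \<longleftrightarrow> (\<forall>j. M *v axis j 1 = M' *v axis j (1::real))"
  by (auto simp: matrix_vector_mult_basis column_def vec_eq_iff)

lemma minus_matrix_vector: "(- X) *v y = - (X *v (y::real^'n))"
  by (simp add: matrix_vector_mult_def vec_eq_iff sum_negf)

lemma minus_vector_matrix: "(- y) v* X = - (y v* (X::real^'n^'m))" "y v* (- X) = - (y v* X)"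
  by (simp_all add: vector_matrix_mult_def vec_eq_iff sum_negf)

lemma columns_apply: "(\<chi> i k. g k $ i) *v axis j (1::real) = g j"
  by (simp add: matrix_vector_mult_basis column_def vec_eq_iff)

text \<open>An envelope identity: once control and multiplier follow the affine feedback, the
  gradient of the value model in the state depends on the gains only through the total steps, paired
  with the mixed blocks \<open>B\<close> and \<open>cx\<close>. To see it, eliminate
  \<open>q\<close>, \<open>cv\<close>, \<open>B\<close> and \<open>cx\<close> by the four block
  equations; symmetry of \<open>H\<close> makes the rest cancel.\<close>

lemma kkt_value_gradient:
  fixes H :: "real^'u^'u" and A :: "real^'c^'u" and B :: "real^'x^'u"
  assumes sol: "kkt_solution H A q B cv cx (\<alpha>, \<beta>, \<psi>, \<omega>)" and sym: "transpose H = H"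
  shows "q v* \<beta> + cv v* \<omega> + (transpose \<beta> ** H ** \<beta> + transpose B ** \<beta> + transpose \<beta> ** B) *v d
           = (\<alpha> + \<beta> *v d) v* B + (\<psi> + \<omega> *v d) v* cx"
proof -
  have q: "q = - (H *v \<alpha>) - A *v \<psi>" and cv: "cv = - (\<alpha> v* A)"
    and B: "B = - (H ** \<beta>) - A ** \<omega>" and cx: "cx = - (transpose A ** \<beta>)"
    using sol unfolding kkt_solution_def by (auto simp: algebra_simps eq_neg_iff_add_eq_0)
  have H: "y v* H = H *v y" for y
    using sym by (metis transpose_matrix_vector)
  have 1: "q v* \<beta> + cv v* \<omega> + (transpose \<beta> ** H ** \<beta> + transpose B ** \<beta> + transpose \<beta> ** B) *v d
      = q v* \<beta> + cv v* \<omega> + (H *v (\<beta> *v d) + B *v d) v* \<beta> + (\<beta> *v d) v* B"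
    by (simp add: algebra_simps flip: matrix_vector_mul_assoc)
  have 2: "H *v (\<beta> *v d) + B *v d = - (A *v (\<omega> *v d))"
    unfolding B by (simp add: algebra_simps minus_matrix_vector flip: matrix_vector_mul_assoc)
  have 3: "q v* \<beta> + cv v* \<omega> = \<alpha> v* B + \<psi> v* cx"
    unfolding q cv B cx by (simp add: algebra_simps minus_matrix_vector minus_vector_matrix H flip: vector_matrix_mul_assoc)
  have 4: "- (A *v (\<omega> *v d)) v* \<beta> = (\<omega> *v d) v* cx"
    unfolding cx by (simp add: minus_vector_matrix flip: vector_matrix_mul_assoc)
  show ?thesis
    by (rule trans[OF 1]) (unfold 2 3 4, simp add: algebra_simps)
qed

text \<open>The matrix unknowns decouple into columns, each a vector system with the same
  \<open>H\<close> and \<open>A\<close>, so the vector results carry over.\<close>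

lemma kkt_solution_iff_columns:
  "kkt_solution H A q B cv cx (\<alpha>, \<beta>, \<psi>, \<omega>) \<longleftrightarrow>
     (H *v \<alpha> + A *v \<psi> = - q \<and> transpose A *v \<alpha> = - cv) \<and>
     (\<forall>j. H *v (\<beta> *v axis j 1) + A *v (\<omega> *v axis j 1) = - (B *v axis j 1) \<and>
          transpose A *v (\<beta> *v axis j 1) = - (cx *v axis j 1))"
proof -
  show ?thesis
    unfolding kkt_solution_def matrix_eq_columns
    by (auto simp: algebra_simps minus_matrix_vector simp flip: matrix_vector_mul_assoc)
qed

lemma kkt_solution_exists:
  fixes H :: "real^'u^'u" and A :: "real^'c^'u" and B :: "real^'x^'u"
  assumes inj: "\<And>\<xi> \<eta>. H *v \<xi> + A *v \<eta> = 0 \<Longrightarrow> transpose A *v \<xi> = 0 \<Longrightarrow> \<xi> = 0 \<and> \<eta> = 0"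
  shows "\<exists>s. kkt_solution H A q B cv cx s"
proof -
  obtain \<alpha> \<psi> where 1: "H *v \<alpha> + A *v \<psi> = - q" "transpose A *v \<alpha> = - cv"
    using kkt_surj[OF inj] by metis
  have "\<exists>\<xi> \<eta>. H *v \<xi> + A *v \<eta> = - (B *v axis j 1) \<and> transpose A *v \<xi> = - (cx *v axis j 1)" for j
    using kkt_surj[OF inj] by metis
  then obtain b o' where 2: "\<And>j. H *v b j + A *v o' j = - (B *v axis j 1) \<and> transpose A *v b j = - (cx *v axis j 1)"
    by metis
  have "kkt_solution H A q B cv cx (\<alpha>, \<chi> i k. b k $ i, \<psi>, \<chi> i k. o' k $ i)"
    unfolding kkt_solution_iff_columns columns_apply using 1 2 by blast
  then show ?thesis by blast
qed

text \<open>Pairing the first equation with \<open>\<xi>\<close> removes the \<open>A\<close> term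
  because of the second one. Positivity on the null space then forces \<open>\<xi> = 0\<close>, and
  injectivity of \<open>A\<close> forces \<open>\<eta> = 0\<close>.\<close>

lemma kkt_injective:
  fixes H :: "real^'u^'u" and A :: "real^'c^'u"
  assumes pos: "\<And>\<xi>. \<xi> \<noteq> 0 \<Longrightarrow> transpose A *v \<xi> = 0 \<Longrightarrow> \<xi> \<bullet> (H *v \<xi>) > 0"
    and A: "\<And>\<eta>. A *v \<eta> = 0 \<Longrightarrow> \<eta> = 0"
    and eq: "H *v \<xi> + A *v \<eta> = 0" "transpose A *v \<xi> = 0"
  shows "\<xi> = 0 \<and> \<eta> = 0"
proof -
  have "\<xi> \<bullet> (A *v \<eta>) = 0"
    using eq(2) by (simp add: dot_lmul_matrix[symmetric])
  then have "\<xi> \<bullet> (H *v \<xi>) = 0"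
    using arg_cong[OF eq(1), of "\<lambda>y. \<xi> \<bullet> y"] by (simp add: inner_add_right)
  then have "\<xi> = 0" using pos[of \<xi>] eq(2) by fastforce
  then show ?thesis using A eq(1) by simp
qed

text \<open>A non-zero kernel vector is an eigenvector of \<open>transpose A ** A\<close> for the
  eigenvalue 0, which puts 0 among the singular values and pushes their infimum down to at most
  0.\<close>

lemma injective_if_min_singular_value_pos:
  assumes "0 < min_singular_value A" and "A *v \<eta> = 0"
  shows "\<eta> = 0"
proof (rule ccontr)
  assume "\<eta> \<noteq> 0"
  moreover have "(transpose A ** A) *v \<eta> = 0"
    using assms(2) by (simp flip: matrix_vector_mul_assoc)
  ultimately have "0 \<in> singular_values A"
    unfolding singular_values_def by (auto intro!: exI[of _ \<eta>])
  moreover have "bdd_below (singular_values A)"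
    by (rule bdd_belowI[of _ 0]) (auto simp: singular_values_def)
  ultimately have "min_singular_value A \<le> 0"
    unfolding min_singular_value_def by (rule cInf_lower)
  with assms(1) show False by simp
qed

section \<open>Convergence of the gains and error propagation through one stage\<close>

context small_error
begin

lemma near_column:
  fixes M :: "'w \<Rightarrow> real^'n^'m"
  shows "near M M0 \<Longrightarrow> near (\<lambda>w. M w *v y) (M0 *v y)"
  by (rule near_bilinear[OF bounded_bilinear_matrix_vector_mul _ near_const])

lemma ord_vector_matrix:
  fixes M :: "'w \<Rightarrow> real^'n^'m"
  assumes "ord k g" and "near M M0"
  shows "ord k (\<lambda>w. g w v* M w)"
  by (rule ord_bilinear'[OF bounded_bilinear_vector_matrix_mul assms(1) near_ord0[OF assms(2)]]) simp

lemma near_minus: "near g a \<Longrightarrow> near (\<lambda>w. - g w) (- a)"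
  by (rule near_linear[OF bounded_linear_minus[OF bounded_linear_ident]])

lemma near_gains:
  fixes H :: "'w \<Rightarrow> real^'u^'u" and A :: "'w \<Rightarrow> real^'c^'u" and B :: "'w \<Rightarrow> real^'x^'u"
  assumes H: "near H H0" and A: "near A A0" and q: "near q q0" and B: "near B B0"
    and cv: "near cv cv0" and cx: "near cx cx0"
    and inj: "\<And>\<xi> \<eta>. H0 *v \<xi> + A0 *v \<eta> = 0 \<Longrightarrow> transpose A0 *v \<xi> = 0 \<Longrightarrow> \<xi> = 0 \<and> \<eta> = 0"
    and sol: "\<forall>\<^sub>F w in F. kkt_solution (H w) (A w) (q w) (B w) (cv w) (cx w) (\<alpha> w, \<beta> w, \<psi> w, \<omega> w)"
    and sol0: "kkt_solution H0 A0 q0 B0 cv0 cx0 (\<alpha>0, \<beta>0, \<psi>0, \<omega>0)"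
  shows "near \<alpha> \<alpha>0" "near \<beta> \<beta>0" "near \<psi> \<psi>0" "near \<omega> \<omega>0"
proof -
  note sol' = sol[unfolded kkt_solution_iff_columns] and sol0' = sol0[unfolded kkt_solution_iff_columns]
  have ev: "\<forall>\<^sub>F w in F. H w *v \<alpha> w + A w *v \<psi> w = - q w"
    "\<forall>\<^sub>F w in F. transpose (A w) *v \<alpha> w = - cv w"
    "\<And>j. \<forall>\<^sub>F w in F. H w *v (\<beta> w *v axis j 1) + A w *v (\<omega> w *v axis j 1) = - (B w *v axis j 1)"
    "\<And>j. \<forall>\<^sub>F w in F. transpose (A w) *v (\<beta> w *v axis j 1) = - (cx w *v axis j 1)"
    using sol' by (auto elim!: eventually_mono)
  show "near \<alpha> \<alpha>0" "near \<psi> \<psi>0"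
    using near_kkt[OF H A inj near_minus[OF q] ev(1) _ near_minus[OF cv] ev(2)] sol0' by auto
  have "near (\<lambda>w. \<beta> w *v axis j 1) (\<beta>0 *v axis j 1) \<and> near (\<lambda>w. \<omega> w *v axis j 1) (\<omega>0 *v axis j 1)" for j
  proof -
    have z: "H0 *v (\<beta>0 *v axis j 1) + A0 *v (\<omega>0 *v axis j 1) = - (B0 *v axis j 1)"
      "transpose A0 *v (\<beta>0 *v axis j 1) = - (cx0 *v axis j 1)"
      using sol0' by blast+
    show ?thesis
      using near_kkt[OF H A inj near_minus[OF near_column[OF B]] ev(3)[of j] z(1)
          near_minus[OF near_column[OF cx]] ev(4)[of j] z(2)] by blast
  qed
  then show "near \<beta> \<beta>0" "near \<omega> \<omega>0"
    by (auto intro: near_matI)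
qed

text \<open>
  The hypotheses \<open>r1\<close>, \<open>r2\<close>, \<open>r4\<close>, \<open>r5\<close> are first-order Taylor expansions, at the current iterate, of the
  constraint, the dynamics and the two stationarity conditions, evaluated at the optimal point; \<open>r3\<close>
  says that \<open>V + P y\<close> is the multiplier of the optimal point up to second order.
\<close>
lemma stage_error:
  fixes H :: "'w \<Rightarrow> real^'u^'u" and A :: "'w \<Rightarrow> real^'c^'u" and B :: "'w \<Rightarrow> real^'x^'u" and C P :: "'w \<Rightarrow> real^'x^'x"
    and fx :: "'w \<Rightarrow> real^'x^'x" and fu :: "'w \<Rightarrow> real^'u^'x"
  assumes r1: "ord 2 (\<lambda>w. cv w + cx w *v dx w + du w v* A w)"
    and r2: "ord 2 (\<lambda>w. y w - fx w *v dx w - fu w *v du w)"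
    and r3: "ord 2 (\<lambda>w. V w + P w *v y w - ls)"
    and r4: "ord 2 (\<lambda>w. gu w + ls v* fu w + H0 w *v du w + B0 w *v dx w + A w *v dphi w)"
    and r5: "ord 2 (\<lambda>w. gx w + ls v* fx w + C0 w *v dx w + du w v* B0 w + dphi w v* cx w - ls')"
    and H: "near H Hs" and A: "near A As" and B: "near B Bs" and cx: "near cx cxs"
    and fx: "near fx fxs" and fu: "near fu fus" and P: "near P Ps"
    and inj: "\<And>\<xi> \<eta>. Hs *v \<xi> + As *v \<eta> = 0 \<Longrightarrow> transpose As *v \<xi> = 0 \<Longrightarrow> \<xi> = 0 \<and> \<eta> = 0"
    and H_eq: "\<And>w. H w = H0 w + transpose (fu w) ** P w ** fu w"
    and B_eq: "\<And>w. B w = B0 w + transpose (fu w) ** P w ** fx w"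
    and C_eq: "\<And>w. C w = C0 w + transpose (fx w) ** P w ** fx w"
    and sol: "\<forall>\<^sub>F w in F. transpose (H w) = H w \<and> transpose (P w) = P w \<and>
      kkt_solution (H w) (A w) (gu w + V w v* fu w) (B w) (cv w) (cx w) (\<alpha> w, \<beta> w, \<psi> w, \<omega> w)"
  shows "ord 2 (\<lambda>w. \<alpha> w + \<beta> w *v dx w - du w)" (is "ord 2 ?s1")
    and "ord 2 (\<lambda>w. \<psi> w + \<omega> w *v dx w - dphi w)" (is "ord 2 ?s2")
    and "ord 2 (\<lambda>w. (gx w + V w v* fx w) + (gu w + V w v* fu w) v* \<beta> w + cv w v* \<omega> w
           + (C w + transpose (\<beta> w) ** H w ** \<beta> w + transpose (B w) ** \<beta> w + transpose (\<beta> w) ** B w) *v dx w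
           - ls')"
proof -
  \<comment> \<open>Trading \<open>y\<close> for its linearisation costs only \<open>P\<close>,
    which is bounded, times a second-order remainder. \<open>z\<close> is the multiplier error
    written in \<open>dx\<close> and \<open>du\<close>.\<close>
  define z where "z w = (V w + P w *v y w - ls) - P w *v (y w - fx w *v dx w - fu w *v du w)" for w
  have z: "ord 2 z"
    unfolding z_def
    by (rule ord_diff[OF r3 ord_bilinear'[OF bounded_bilinear_matrix_vector_mul near_ord0[OF P] r2]]) simp
  have z_eq: "z w = V w + P w *v (fx w *v dx w + fu w *v du w) - ls" for w
    by (simp add: z_def algebra_simps)
  \<comment> \<open>Adding \<open>z w v* fu w\<close> replaces \<open>ls\<close> by
    \<open>V w\<close> and supplies exactly the \<open>P\<close> terms that turn \<open>H0\<close>,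
    \<open>B0\<close> into \<open>H\<close>, \<open>B\<close>. The stationarity condition becomes
    the first block row of the system, satisfied by the true displacements up to
    \<open>k\<close>.\<close>
  define k where "k w = (gu w + ls v* fu w + H0 w *v du w + B0 w *v dx w + A w *v dphi w) + z w v* fu w" for w
  have k: "ord 2 k"
    unfolding k_def by (rule ord_add[OF r4 ord_vector_matrix[OF z fu]])
  have k_eq: "k w = gu w + V w v* fu w + H w *v du w + B w *v dx w + A w *v dphi w" for w
    by (simp add: k_def z_eq H_eq B_eq algebra_simps flip: matrix_vector_mul_assoc)
  have a1: "ord 2 (\<lambda>w. H w *v ?s1 w + A w *v ?s2 w)"
  proof (rule ord_cong[OF ord_minus[OF k]], rule eventually_mono[OF sol])
    fix w
    assume "transpose (H w) = H w \<and> transpose (P w) = P w \<and>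
      kkt_solution (H w) (A w) (gu w + V w v* fu w) (B w) (cv w) (cx w) (\<alpha> w, \<beta> w, \<psi> w, \<omega> w)"
    then have 1: "H w *v \<alpha> w + A w *v \<psi> w = - (gu w + V w v* fu w)"
      and 2: "H w ** \<beta> w + A w ** \<omega> w = - B w"
      by (auto simp: kkt_solution_def)
    from 2 have "(H w ** \<beta> w + A w ** \<omega> w) *v dx w = (- B w) *v dx w" by simp
    then have "H w *v (\<beta> w *v dx w) + A w *v (\<omega> w *v dx w) = - (B w *v dx w)"
      by (simp add: minus_matrix_vector algebra_simps flip: matrix_vector_mul_assoc)
    with 1 show "H w *v ?s1 w + A w *v ?s2 w = - k w"
      by (simp add: k_eq algebra_simps)
  qed
  have a2: "ord 2 (\<lambda>w. transpose (A w) *v ?s1 w)"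
  proof (rule ord_cong[OF ord_minus[OF r1]], rule eventually_mono[OF sol])
    fix w
    assume "transpose (H w) = H w \<and> transpose (P w) = P w \<and>
      kkt_solution (H w) (A w) (gu w + V w v* fu w) (B w) (cv w) (cx w) (\<alpha> w, \<beta> w, \<psi> w, \<omega> w)"
    then have 1: "transpose (A w) *v \<alpha> w = - cv w"
      and 2: "transpose (A w) ** \<beta> w = - cx w"
      by (auto simp: kkt_solution_def)
    from 2 have "(transpose (A w) ** \<beta> w) *v dx w = (- cx w) *v dx w" by simp
    then have "(\<beta> w *v dx w) v* A w = - (cx w *v dx w)"
      by (simp add: minus_matrix_vector flip: matrix_vector_mul_assoc)
    with 1 show "transpose (A w) *v ?s1 w = - (cv w + cx w *v dx w + du w v* A w)"
      by (simp add: algebra_simps)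
  qed
  show s: "ord 2 ?s1" "ord 2 ?s2"
    using ord_kkt[OF H A _ a1 a2] inj by blast+
  \<comment> \<open>By the envelope identity the claimed error is this sum: the expansion in
    \<open>x\<close>, the multiplier error carried through \<open>fx\<close>, and the step errors
    carried through \<open>B\<close> and \<open>cx\<close>.\<close>
  have "ord 2 (\<lambda>w. (gx w + ls v* fx w + C0 w *v dx w + du w v* B0 w + dphi w v* cx w - ls')
      + z w v* fx w + (?s1 w v* B w + ?s2 w v* cx w))"
    by (rule ord_add[OF ord_add[OF r5 ord_vector_matrix[OF z fx]] ord_add[OF ord_vector_matrix[OF s(1) B] ord_vector_matrix[OF s(2) cx]]])
  then show "ord 2 (\<lambda>w. (gx w + V w v* fx w) + (gu w + V w v* fu w) v* \<beta> w + cv w v* \<omega> w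
           + (C w + transpose (\<beta> w) ** H w ** \<beta> w + transpose (B w) ** \<beta> w + transpose (\<beta> w) ** B w) *v dx w
           - ls')"
  proof (rule ord_cong, intro eventually_mono[OF sol])
    fix w
    let ?q = "gu w + V w v* fu w"
    assume a: "transpose (H w) = H w \<and> transpose (P w) = P w \<and>
      kkt_solution (H w) (A w) ?q (B w) (cv w) (cx w) (\<alpha> w, \<beta> w, \<psi> w, \<omega> w)"
    have v: "?q v* \<beta> w + cv w v* \<omega> w
        + (transpose (\<beta> w) ** H w ** \<beta> w + transpose (B w) ** \<beta> w + transpose (\<beta> w) ** B w) *v dx w
        = (\<alpha> w + \<beta> w *v dx w) v* B w + (\<psi> w + \<omega> w *v dx w) v* cx w"
      using a by (intro kkt_value_gradient) auto
    \<comment> \<open>Symmetry of \<open>P\<close> makes the \<open>P\<close> part of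
      \<open>du w v* B w\<close> agree with the term that \<open>z\<close> contributes through
      \<open>fx\<close>.\<close>
    have P: "v v* P w = P w *v v" for v
      using a by (metis transpose_matrix_vector)
    have "du w v* B w = du w v* B0 w + (P w *v (fu w *v du w)) v* fx w"
      by (simp add: B_eq algebra_simps P flip: vector_matrix_mul_assoc)
    then have "z w v* fx w = V w v* fx w + (C w *v dx w - C0 w *v dx w) + (du w v* B w - du w v* B0 w) - ls v* fx w"
      by (simp add: z_eq C_eq algebra_simps flip: matrix_vector_mul_assoc)
    moreover have "(gx w + V w v* fx w) + ?q v* \<beta> w + cv w v* \<omega> w
           + (C w + transpose (\<beta> w) ** H w ** \<beta> w + transpose (B w) ** \<beta> w + transpose (\<beta> w) ** B w) *v dx w
           - ls' = (gx w + V w v* fx w) + C w *v dx w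
           + ((\<alpha> w + \<beta> w *v dx w) v* B w + (\<psi> w + \<omega> w *v dx w) v* cx w) - ls'"
      unfolding v[symmetric] by (simp add: matrix_vector_mult_add_rdistrib)
    moreover have "(\<alpha> w + \<beta> w *v dx w) v* B w = ?s1 w v* B w + du w v* B w"
      "(\<psi> w + \<omega> w *v dx w) v* cx w = ?s2 w v* cx w + dphi w v* cx w"
      by (simp_all add: algebra_simps)
    ultimately show "(gx w + V w v* fx w) + ?q v* \<beta> w + cv w v* \<omega> w
           + (C w + transpose (\<beta> w) ** H w ** \<beta> w + transpose (B w) ** \<beta> w + transpose (\<beta> w) ** B w) *v dx w
           - ls' = (gx w + ls v* fx w + C0 w *v dx w + du w v* B0 w + dphi w v* cx w - ls')
      + z w v* fx w + (?s1 w v* B w + ?s2 w v* cx w)"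
      by simp
  qed
qed

end

section \<open>Derivatives of the problem data\<close>

lemma jacobian_apply:
  fixes g :: "real^'n \<Rightarrow> real^'m"
  assumes "(g has_derivative g') (at y)"
  shows "jacobian g (at y) *v v = g' v"
  unfolding jacobian_def frechet_derivative_at[OF assms, symmetric]
  using matrix_vector_mul(2)[OF has_derivative_linear[OF assms]] by metis

lemma gradient_eq:
  assumes "(h has_derivative h') (at y)"
  shows "gradient h y = (\<chi> i. h' (axis i 1))"
  using frechet_derivative_at[OF assms] by (simp add: gradient_def)

lemma vector_matrix_mult_nth: "(v v* M) $ i = v \<bullet> (M *v axis i (1::real))"
  by (simp add: matrix_vector_mult_basis column_def vector_matrix_mult_def inner_vec_def mult.commute)

lemma contract_apply:
  fixes T :: "'k::finite \<Rightarrow> real^'n^'m"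
  shows "contract v T *v y = (\<Sum>i\<in>UNIV. v $ i *\<^sub>R (T i *v y))"
proof -
  have "linear (\<lambda>M::real^'n^'m. M *v y)"
    by (intro linearI) (simp_all add: algebra_simps scaleR_matrix_vector_assoc)
  then show ?thesis
    unfolding contract_def by (simp only: linear_sum[where f = "\<lambda>M. M *v y"] scaleR_matrix_vector_assoc)
qed

text \<open>Cost, constraint and dynamics are bundled into one map, so that a single
  \<open>D\<close>, \<open>D2\<close> and constant \<open>K\<close> serve all three. The gradients
  and Hessians of the backward pass then become scalar weightings of \<open>D\<close> and
  \<open>D2\<close>.\<close>

locale ocp_derivatives =
  fixes l :: "(real^'x) \<times> (real^'u) \<Rightarrow> real"
    and f :: "(real^'x) \<times> (real^'u) \<Rightarrow> real^'x"
    and c :: "(real^'x) \<times> (real^'u) \<Rightarrow> real^'c"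
    and S :: "((real^'x) \<times> (real^'u)) set"
    and D :: "(real^'x) \<times> (real^'u) \<Rightarrow> ((real^'x) \<times> (real^'u)) \<Rightarrow>\<^sub>L (real \<times> (real^'c) \<times> (real^'x))"
    and D2 :: "(real^'x) \<times> (real^'u) \<Rightarrow> ((real^'x) \<times> (real^'u)) \<Rightarrow>\<^sub>L
                 (((real^'x) \<times> (real^'u)) \<Rightarrow>\<^sub>L (real \<times> (real^'c) \<times> (real^'x)))"
    and K :: real
  assumes open_S: "open S" and convex_S: "convex S"
    and D: "z \<in> S \<Longrightarrow> ((\<lambda>z. (l z, c z, f z)) has_derivative blinfun_apply (D z)) (at z)"
    and D2: "z \<in> S \<Longrightarrow> (D has_derivative blinfun_apply (D2 z)) (at z)"
    and lipschitz_D: "K-lipschitz_on S D"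
    and lipschitz_D2: "K-lipschitz_on S D2"
begin

text \<open>For the weight \<open>(1, \<phi>, \<lambda>)\<close> this is the Hamiltonian of the
  control problem.\<close>

definition weighted :: "real \<times> (real^'c) \<times> (real^'x) \<Rightarrow> (real^'x) \<times> (real^'u) \<Rightarrow> real" where
  "weighted \<mu> z = \<mu> \<bullet> (l z, c z, f z)"

lemma lagrangian_weighted: "lagrangian l c \<phi> = weighted (1, \<phi>, 0)"
  by (auto simp: lagrangian_def weighted_def)

lemma component_weighted: "(\<lambda>z. f z $ i) = weighted (0, 0, axis i 1)"
  by (auto simp: weighted_def inner_axis inner_commute[of "axis i 1"])

lemma D2_symmetric: "z \<in> S \<Longrightarrow> D2 z a b = D2 z b a"
  using second_derivative_symmetric[OF open_S _ D D2 lipschitz_D2] .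

lemma weighted_has_derivative:
  assumes "z \<in> S"
  shows "(weighted \<mu> has_derivative (\<lambda>v. \<mu> \<bullet> D z v)) (at z)"
  unfolding weighted_def by (intro has_derivative_inner_right D assms)

lemma partial_x:
  assumes "(g has_derivative g') (at z)"
  shows "((\<lambda>x. g (x, snd z)) has_derivative (\<lambda>v. g' (v, 0))) (at (fst z))"
proof -
  have "((\<lambda>x. (x, snd z)) has_derivative (\<lambda>v. (v, 0))) (at (fst z))"
    by (intro derivative_intros)
  from diff_chain_at[OF this, of g g'] show ?thesis
    using assms by (simp add: o_def)
qed

lemma partial_u:
  assumes "(g has_derivative g') (at z)"
  shows "((\<lambda>u. g (fst z, u)) has_derivative (\<lambda>v. g' (0, v))) (at (snd z))"
proof -
  have "((\<lambda>u. (fst z, u)) has_derivative (\<lambda>v. (0, v))) (at (snd z))"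
    by (intro derivative_intros)
  from diff_chain_at[OF this, of g g'] show ?thesis
    using assms by (simp add: o_def)
qed

lemma grad_x_weighted: "z \<in> S \<Longrightarrow> grad_x (weighted \<mu>) z = (\<chi> i. \<mu> \<bullet> D z (axis i 1, 0))"
  unfolding grad_x_def by (rule gradient_eq[OF partial_x[OF weighted_has_derivative]])

lemma grad_u_weighted: "z \<in> S \<Longrightarrow> grad_u (weighted \<mu>) z = (\<chi> i. \<mu> \<bullet> D z (0, axis i 1))"
  unfolding grad_u_def by (rule gradient_eq[OF partial_u[OF weighted_has_derivative]])

lemma grad_has_derivative:
  fixes g :: "(real^'x) \<times> (real^'u) \<Rightarrow> real^'a"
  assumes z: "z \<in> S" and g: "\<And>z. z \<in> S \<Longrightarrow> g z = (\<chi> i. \<mu> \<bullet> D z (a i))"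
  shows "(g has_derivative (\<lambda>v. \<chi> i. \<mu> \<bullet> D2 z v (a i))) (at z)"
proof (rule has_derivative_transform_within_open[OF _ open_S z])
  show "((\<lambda>z. \<chi> i. \<mu> \<bullet> D z (a i)) has_derivative (\<lambda>v. \<chi> i. \<mu> \<bullet> D2 z v (a i))) (at z)"
  proof (rule has_derivative_componentwise_within[THEN iffD2], intro ballI)
    fix b :: "real^'a" assume "b \<in> Basis"
    then obtain i where b: "b = axis i 1" by (auto simp: Basis_vec_def)
    show "((\<lambda>z. (\<chi> i. \<mu> \<bullet> D z (a i)) \<bullet> b) has_derivative (\<lambda>v. (\<chi> i. \<mu> \<bullet> D2 z v (a i)) \<bullet> b)) (at z)"
      unfolding b inner_axis
      by (simp add: has_derivative_inner_right
        bounded_linear.has_derivative[OF blinfun.bounded_linear_left] D2[OF z])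
  qed
qed (simp add: g)

lemma hess_xx_weighted: "z \<in> S \<Longrightarrow> hess_xx (weighted \<mu>) z *v v = (\<chi> i. \<mu> \<bullet> D2 z (v, 0) (axis i 1, 0))"
  unfolding hess_xx_def
  by (rule jacobian_apply[OF partial_x[OF grad_has_derivative]]) (auto simp: grad_x_weighted)

lemma hess_ux_weighted: "z \<in> S \<Longrightarrow> hess_ux (weighted \<mu>) z *v v = (\<chi> i. \<mu> \<bullet> D2 z (v, 0) (0, axis i 1))"
  unfolding hess_ux_def
  by (rule jacobian_apply[OF partial_x[OF grad_has_derivative]]) (auto simp: grad_u_weighted)

lemma hess_uu_weighted: "z \<in> S \<Longrightarrow> hess_uu (weighted \<mu>) z *v v = (\<chi> i. \<mu> \<bullet> D2 z (0, v) (0, axis i 1))"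
  unfolding hess_uu_def
  by (rule jacobian_apply[OF partial_u[OF grad_has_derivative]]) (auto simp: grad_u_weighted)

lemma jac_f_c:
  assumes "z \<in> S"
  shows "jac_x f z *v v = snd (snd (D z (v, 0)))" "jac_u f z *v w = snd (snd (D z (0, w)))"
    and "jac_x c z *v v = fst (snd (D z (v, 0)))" "jac_u c z *v w = fst (snd (D z (0, w)))"
proof -
  have d: "(f has_derivative (\<lambda>v. snd (snd (D z v)))) (at z)" "(c has_derivative (\<lambda>v. fst (snd (D z v)))) (at z)"
    using has_derivative_snd[OF has_derivative_snd[OF D[OF assms]]]
      has_derivative_fst[OF has_derivative_snd[OF D[OF assms]]] by simp_all
  show "jac_x f z *v v = snd (snd (D z (v, 0)))" "jac_u f z *v w = snd (snd (D z (0, w)))"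
    and "jac_x c z *v v = fst (snd (D z (v, 0)))" "jac_u c z *v w = fst (snd (D z (0, w)))"
    using d[THEN partial_x, THEN jacobian_apply, of v] d[THEN partial_u, THEN jacobian_apply, of w]
    by (simp_all add: jac_x_def jac_u_def)
qed

lemma sum_component: "(\<Sum>k\<in>UNIV. v $ k * ((0, 0, axis k 1) \<bullet> X)) = (0, 0, v) \<bullet> (X :: real \<times> (real^'c) \<times> (real^'x))"
proof -
  obtain a b y where "X = (a, b, y)" by (metis prod_cases3)
  then show ?thesis by (simp add: inner_axis') (simp add: inner_vec_def)
qed

lemma split_weight: "(1, \<phi>, 0) \<bullet> X + (0, 0, v) \<bullet> X = (1, \<phi>, v) \<bullet> (X :: real \<times> (real^'c) \<times> (real^'x))"
  unfolding inner_add_left[symmetric] by simp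

text \<open>Setting \<open>P = 0\<close> isolates the second derivatives: the Hessian of the
  Lagrangian and the contraction with \<open>lam\<close> merge into one Hessian of the Hamiltonian.
  \<open>Q_mat_split\<close> puts the curvature inherited through \<open>P\<close> back.\<close>

lemma Q_mat_apply:
  assumes "xu p \<in> S"
  shows "H_mat l f c p lam 0 *v u = (\<chi> i. (1, mult p, lam) \<bullet> D2 (xu p) (0, u) (0, axis i 1))"
    and "B_mat l f c p lam 0 *v x = (\<chi> i. (1, mult p, lam) \<bullet> D2 (xu p) (x, 0) (0, axis i 1))"
    and "C_mat l f c p lam 0 *v x = (\<chi> i. (1, mult p, lam) \<bullet> D2 (xu p) (x, 0) (axis i 1, 0))"
  unfolding H_mat_def B_mat_def C_mat_def lagrangian_weighted component_weighted
  by (simp_all add: vec_eq_iff matrix_vector_mult_add_rdistrib contract_apply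
      hess_uu_weighted hess_ux_weighted hess_xx_weighted assms sum_component split_weight)

lemma Q_vec_nth:
  assumes "xu p \<in> S"
  shows "Qx_vec l f c p V $ i = (1, mult p, V) \<bullet> D (xu p) (axis i 1, 0)"
    and "Qu_vec l f c p V $ k = (1, mult p, V) \<bullet> D (xu p) (0, axis k 1)"
proof -
  have "V \<bullet> snd (snd X) = (0, 0, V) \<bullet> X" for X :: "real \<times> (real^'c) \<times> (real^'x)"
    by (cases X) auto
  then show "Qx_vec l f c p V $ i = (1, mult p, V) \<bullet> D (xu p) (axis i 1, 0)"
    and "Qu_vec l f c p V $ k = (1, mult p, V) \<bullet> D (xu p) (0, axis k 1)"
    unfolding Qx_vec_def Qu_vec_def lagrangian_weighted
    by (simp_all add: vector_matrix_mult_nth jac_f_c grad_x_weighted grad_u_weighted assms split_weight)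
qed

end

lemma Q_mat_split:
  "H_mat l f c p lam P = H_mat l f c p lam 0 + transpose (jac_u f (xu p)) ** P ** jac_u f (xu p)"
  "B_mat l f c p lam P = B_mat l f c p lam 0 + transpose (jac_u f (xu p)) ** P ** jac_x f (xu p)"
  "C_mat l f c p lam P = C_mat l f c p lam 0 + transpose (jac_x f (xu p)) ** P ** jac_x f (xu p)"
  unfolding H_mat_def B_mat_def C_mat_def by (simp_all add: matrix_eq algebra_simps flip: matrix_vector_mul_assoc)

lemma symmetric_sandwich:
  assumes "transpose P = (P :: real^'n^'n)"
  shows "transpose (transpose X ** P ** X) = transpose X ** P ** X"
  by (simp add: matrix_transpose_mul transpose_transpose assms matrix_mul_assoc)

lemma transpose_add: "transpose (X + Y) = transpose X + transpose (Y :: real^'n^'m)"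
  by (simp add: transpose_def vec_eq_iff)

lemma symmetricI:
  fixes M :: "real^'n^'n"
  assumes "\<And>i j. (M *v axis j 1) $ i = (M *v axis i 1) $ j"
  shows "transpose M = M"
  using assms by (simp add: matrix_vector_mult_basis column_def transpose_def vec_eq_iff)

context ocp_derivatives
begin

lemma Q_mat_symmetric:
  assumes "xu p \<in> S" and "transpose P = P"
  shows "transpose (H_mat l f c p lam P) = H_mat l f c p lam P"
    and "transpose (C_mat l f c p lam P) = C_mat l f c p lam P"
proof -
  have "transpose (H_mat l f c p lam 0) = H_mat l f c p lam 0"
    "transpose (C_mat l f c p lam 0) = C_mat l f c p lam 0"
    by (rule symmetricI, simp add: Q_mat_apply assms(1) D2_symmetric[OF assms(1)])+
  then show "transpose (H_mat l f c p lam P) = H_mat l f c p lam P"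
    and "transpose (C_mat l f c p lam P) = C_mat l f c p lam P"
    by (simp_all add: Q_mat_split[of _ _ _ _ _ P] transpose_add symmetric_sandwich assms(2))
qed

text \<open>\<open>B\<close> differentiates the \<open>u\<close>-gradient in direction
  \<open>x\<close>, while the stationarity condition in \<open>x\<close> needs the
  \<open>x\<close>-gradient differentiated in direction \<open>u\<close>. Symmetry of
  \<open>D2\<close> identifies the latter with the transpose of \<open>B\<close>.\<close>

lemma B_mat_transpose_nth:
  assumes "xu p \<in> S"
  shows "(u v* B_mat l f c p lam 0) $ i = (1, mult p, lam) \<bullet> D2 (xu p) (0, u) (axis i 1, 0)"
proof -
  have lin: "linear (\<lambda>y. (1, mult p, lam) \<bullet> D2 (xu p) (axis i 1, 0) (0, y))"
    by (intro linearI) (auto simp flip: inner_add_right inner_scaleR_right blinfun.add_right blinfun.scaleR_right)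
  have "(1, mult p, lam) \<bullet> D2 (xu p) (axis i 1, 0) (0, \<Sum>k\<in>UNIV. u $ k *\<^sub>R axis k 1)
      = (\<Sum>k\<in>UNIV. u $ k *\<^sub>R ((1, mult p, lam) \<bullet> D2 (xu p) (axis i 1, 0) (0, axis k 1)))"
    by (simp only: linear_sum[OF lin] linear_scale[OF lin])
  moreover have "(\<Sum>k\<in>UNIV. u $ k *\<^sub>R axis k 1) = u"
    using basis_expansion[of u] by (simp add: scalar_mult_eq_scaleR)
  moreover have "(u v* B_mat l f c p lam 0) $ i
      = (\<Sum>k\<in>UNIV. u $ k *\<^sub>R ((1, mult p, lam) \<bullet> D2 (xu p) (axis i 1, 0) (0, axis k 1)))"
    by (simp add: vector_matrix_mult_nth Q_mat_apply assms inner_vec_def)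
  ultimately show ?thesis
    using D2_symmetric[OF assms] by metis
qed

end

section \<open>One stage of the recursion\<close>

context small_error
begin

lemma ord_small:
  assumes "ord k g" and "0 < k" and "0 < d"
  shows "\<forall>\<^sub>F w in F. norm (g w) < d"
proof -
  have "ord 1 g" using assms by (intro ord_mono[OF assms(1)]) simp
  then obtain M where M: "M > 0" "\<forall>\<^sub>F w in F. norm (g w) \<le> M * e w ^ 1"
    by (rule ordE)
  have "\<forall>\<^sub>F w in F. e w < d / M"
    using M assms by (intro eventually_e_less) simp
  with M(2) show ?thesis
  proof eventually_elim
    case (elim w)
    then show ?case using M(1) by (simp add: pos_less_divide_eq mult.commute)
  qed
qed

text \<open>Differentiability at the single point \<open>a\<close> already bounds increments from
  \<open>a\<close> linearly; tolerance 1 in the definition of the derivative suffices, and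
  \<open>0 < k\<close> brings \<open>g w\<close> into the required ball.\<close>

lemma ord_differentiable:
  assumes f: "(f has_derivative f') (at a)" and g: "ord k (\<lambda>w. g w - a)" and "0 < k"
  shows "ord k (\<lambda>w. f (g w) - f a)"
proof -
  have bl: "bounded_linear f'"
    and "\<exists>d>0. \<forall>y. norm (y - a) < d \<longrightarrow> norm (f y - f a - f' (y - a)) \<le> 1 * norm (y - a)"
    using f unfolding has_derivative_at_alt by (blast, meson zero_less_one)
  then obtain d where d: "d > 0" "\<And>y. norm (y - a) < d \<Longrightarrow> norm (f y - f a - f' (y - a)) \<le> 1 * norm (y - a)"
    by blast
  have "\<forall>\<^sub>F w in F. norm (f (g w) - f a - f' (g w - a)) \<le> 1 * norm (g w - a)"
    using ord_small[OF g \<open>0 < k\<close> d(1)] by eventually_elim (rule d(2))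
  then have "ord k (\<lambda>w. f (g w) - f a - f' (g w - a))"
    by (rule ord_le[OF g]) simp
  from ord_add[OF this ord_linear[OF bl g]] show ?thesis by simp
qed

lemma near_Pair: "near g a \<Longrightarrow> near h b \<Longrightarrow> near (\<lambda>w. (g w, h w)) (a, b)"
  unfolding near_def by (drule (1) ord_Pair) simp

lemma near_differentiable: "(f has_derivative f') (at a) \<Longrightarrow> near g a \<Longrightarrow> near (\<lambda>w. f (g w)) (f a)"
  unfolding near_def by (rule ord_differentiable) auto

lemma near_sandwich:
  fixes X :: "'w \<Rightarrow> real^'n^'a" and P :: "'w \<Rightarrow> real^'a^'b" and Y :: "'w \<Rightarrow> real^'m^'b"
  assumes "near X X0" and "near P P0" and "near Y Y0"
  shows "near (\<lambda>w. transpose (Y w) ** P w ** X w) (transpose Y0 ** P0 ** X0)"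
  by (rule near_bilinear[OF bounded_bilinear_matrix_mul near_bilinear[OF bounded_bilinear_matrix_mul
        near_linear[OF bounded_linear_transpose assms(3)] assms(2)] assms(1)])

end

text \<open>One fixed time: \<open>p w\<close> is the point of the iterate \<open>w\<close> at that
  time and \<open>ps\<close> the optimal point there.\<close>

locale ocp_stage = small_error F e + ocp_derivatives l f c S D D2 K
  for F :: "'w filter" and e :: "'w \<Rightarrow> real"
    and l :: "(real^'x) \<times> (real^'u) \<Rightarrow> real"
    and f :: "(real^'x) \<times> (real^'u) \<Rightarrow> real^'x"
    and c :: "(real^'x) \<times> (real^'u) \<Rightarrow> real^'c"
    and S D D2 K +
  fixes p :: "'w \<Rightarrow> (real^'x) \<times> (real^'u) \<times> (real^'c)" and ps :: "(real^'x) \<times> (real^'u) \<times> (real^'c)"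
  assumes in_S: "\<forall>\<^sub>F w in F. xu (p w) \<in> S"
    and ps_in_S: "xu ps \<in> S"
    and near_p: "near p ps"
begin

definition dx :: "'w \<Rightarrow> real^'x" where "dx w = fst ps - fst (p w)"
definition du :: "'w \<Rightarrow> real^'u" where "du w = fst (snd ps) - fst (snd (p w))"
definition dphi :: "'w \<Rightarrow> real^'c" where "dphi w = mult ps - mult (p w)"

lemma xu_diff: "xu ps - xu (p w) = (dx w, du w)"
  by (simp add: xu_def dx_def du_def)

lemma near_xu: "near (\<lambda>w. xu (p w)) (xu ps)"
  unfolding xu_def
  by (rule near_linear[OF bounded_linear_Pair[OF bounded_linear_fst
        bounded_linear_compose[OF bounded_linear_fst bounded_linear_snd]] near_p])

lemma near_mult: "near (\<lambda>w. mult (p w)) (mult ps)"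
  unfolding mult_def
  by (rule near_linear[OF bounded_linear_compose[OF bounded_linear_snd bounded_linear_snd] near_p])

lemma near_weight: "near lam ls \<Longrightarrow> near (\<lambda>w. (1::real, mult (p w), lam w)) (1, mult ps, ls)"
  by (intro near_Pair near_const near_mult)

lemma near_D: "near (\<lambda>w. D (xu (p w))) (D (xu ps))"
  by (rule near_differentiable[OF D2[OF ps_in_S] near_xu])

text \<open>\<open>D2\<close> may fail to be differentiable, so here the linear rate comes from its
  Lipschitz bound on \<open>S\<close>.\<close>

lemma near_D2: "near (\<lambda>w. D2 (xu (p w))) (D2 (xu ps))"
  unfolding near_def
proof (rule ord_le[OF near_xu[unfolded near_def]])
  show "\<forall>\<^sub>F w in F. norm (D2 (xu (p w)) - D2 (xu ps)) \<le> K * norm (xu (p w) - xu ps)"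
    using in_S by eventually_elim (use lipschitz_on_normD[OF lipschitz_D2] ps_in_S in blast)
  show "0 \<le> K" using lipschitz_D2 by (rule lipschitz_on_nonneg)
qed

lemma near_apply: "near g a \<Longrightarrow> near (\<lambda>w. blinfun_apply (g w) v) (blinfun_apply a v)"
  by (rule near_linear[OF blinfun.bounded_linear_left])

lemma near_weight_D:
  "near lam ls \<Longrightarrow> near (\<lambda>w. (1, mult (p w), lam w) \<bullet> D (xu (p w)) a) ((1, mult ps, ls) \<bullet> D (xu ps) a)"
  by (intro near_bilinear[OF bounded_bilinear_inner] near_weight near_apply near_D)

lemma near_weight_D2:
  "near lam ls \<Longrightarrow> near (\<lambda>w. (1, mult (p w), lam w) \<bullet> D2 (xu (p w)) b a) ((1, mult ps, ls) \<bullet> D2 (xu ps) b a)"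
  by (intro near_bilinear[OF bounded_bilinear_inner] near_weight near_apply near_D2)

lemma near_jac:
  "near (\<lambda>w. jac_x f (xu (p w))) (jac_x f (xu ps))" "near (\<lambda>w. jac_u f (xu (p w))) (jac_u f (xu ps))"
  "near (\<lambda>w. jac_x c (xu (p w))) (jac_x c (xu ps))" "near (\<lambda>w. jac_u c (xu (p w))) (jac_u c (xu ps))"
proof -
  have ss: "near (\<lambda>w. snd (snd (D (xu (p w)) v))) (snd (snd (D (xu ps) v)))"
    and fs: "near (\<lambda>w. fst (snd (D (xu (p w)) v))) (fst (snd (D (xu ps) v)))" for v
    by (rule near_linear[OF bounded_linear_compose[OF bounded_linear_snd bounded_linear_snd] near_apply[OF near_D]],
        rule near_linear[OF bounded_linear_compose[OF bounded_linear_fst bounded_linear_snd] near_apply[OF near_D]])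
  show "near (\<lambda>w. jac_x f (xu (p w))) (jac_x f (xu ps))" "near (\<lambda>w. jac_u f (xu (p w))) (jac_u f (xu ps))"
    by (rule near_matI, unfold jac_f_c[OF ps_in_S], rule near_cong[OF ss], rule eventually_mono[OF in_S],
        rule jac_f_c, assumption)+
  show "near (\<lambda>w. jac_x c (xu (p w))) (jac_x c (xu ps))" "near (\<lambda>w. jac_u c (xu (p w))) (jac_u c (xu ps))"
    by (rule near_matI, unfold jac_f_c[OF ps_in_S], rule near_cong[OF fs], rule eventually_mono[OF in_S],
        rule jac_f_c, assumption)+
qed

lemma near_A: "near (\<lambda>w. A_mat c (p w)) (A_mat c ps)"
  unfolding A_mat_def by (rule near_linear[OF bounded_linear_transpose near_jac(4)])

lemma near_Q_vec:
  assumes "near V Vs"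
  shows "near (\<lambda>w. Qx_vec l f c (p w) (V w)) (Qx_vec l f c ps Vs)"
    and "near (\<lambda>w. Qu_vec l f c (p w) (V w)) (Qu_vec l f c ps Vs)"
  by (rule near_vecI, unfold Q_vec_nth[OF ps_in_S], rule near_cong[OF near_weight_D[OF assms]],
      rule eventually_mono[OF in_S], rule Q_vec_nth, assumption)+

lemma near_Q_mat0:
  assumes "near lam ls"
  shows "near (\<lambda>w. H_mat l f c (p w) (lam w) 0) (H_mat l f c ps ls 0)"
    and "near (\<lambda>w. B_mat l f c (p w) (lam w) 0) (B_mat l f c ps ls 0)"
    and "near (\<lambda>w. C_mat l f c (p w) (lam w) 0) (C_mat l f c ps ls 0)"
  by (rule near_matI, rule near_vecI, unfold Q_mat_apply[OF ps_in_S] vec_lambda_beta,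
      rule near_cong[OF near_weight_D2[OF assms]],
      rule eventually_mono[OF in_S], simp add: Q_mat_apply)+

lemma near_Q_mat:
  assumes "near lam ls" and "near P Ps"
  shows "near (\<lambda>w. H_mat l f c (p w) (lam w) (P w)) (H_mat l f c ps ls Ps)"
    and "near (\<lambda>w. B_mat l f c (p w) (lam w) (P w)) (B_mat l f c ps ls Ps)"
    and "near (\<lambda>w. C_mat l f c (p w) (lam w) (P w)) (C_mat l f c ps ls Ps)"
  unfolding Q_mat_split[of _ _ _ _ _ Ps] Q_mat_split[of _ _ _ _ _ "P _"]
  by (intro near_add near_Q_mat0 near_sandwich near_jac assms)+

text \<open>The expansions are centred at the iterate, where the backward pass evaluates its
  derivatives, and evaluated at the fixed optimal point.\<close>

lemma taylor_stage:
  "ord 2 (\<lambda>w. (l (xu ps), c (xu ps), f (xu ps)) - (l (xu (p w)), c (xu (p w)), f (xu (p w)))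
     - D (xu (p w)) (dx w, du w))"
  "ord 2 (\<lambda>w. D (xu ps) - D (xu (p w)) - D2 (xu (p w)) (dx w, du w))"
proof -
  have K: "0 \<le> K" using lipschitz_D2 by (rule lipschitz_on_nonneg)
  have *: "ord 2 g" if "\<And>w. xu (p w) \<in> S \<Longrightarrow> norm (g w) \<le> K * (norm (xu ps - xu (p w)))\<^sup>2"
    for g :: "'w \<Rightarrow> 'b::real_normed_vector"
  proof (rule ord_le[OF _ _ K])
    have "ord 1 (\<lambda>w. norm (xu (p w) - xu ps))"
      by (rule ord_norm[OF near_xu[unfolded near_def]])
    from ord_bilinear'[OF bounded_bilinear_mult this this, of 2]
    show "ord 2 (\<lambda>w. norm (xu (p w) - xu ps) * norm (xu (p w) - xu ps))" by simp
    show "\<forall>\<^sub>F w in F. norm (g w) \<le> K * norm (norm (xu (p w) - xu ps) * norm (xu (p w) - xu ps))"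
      using in_S by eventually_elim (use that in \<open>simp add: power2_eq_square norm_minus_commute\<close>)
  qed
  show "ord 2 (\<lambda>w. (l (xu ps), c (xu ps), f (xu ps)) - (l (xu (p w)), c (xu (p w)), f (xu (p w)))
     - D (xu (p w)) (dx w, du w))"
    by (rule *, unfold xu_diff[symmetric], rule taylor_lipschitz_derivative[OF convex_S _ ps_in_S D lipschitz_D])
  show "ord 2 (\<lambda>w. D (xu ps) - D (xu (p w)) - D2 (xu (p w)) (dx w, du w))"
    by (rule *, unfold xu_diff[symmetric], rule taylor_lipschitz_derivative[OF convex_S _ ps_in_S D2 lipschitz_D2])
qed

lemma split_arg: "blinfun_apply T (a, 0) + blinfun_apply T (0, b) = blinfun_apply T (a, b)"
  by (simp flip: blinfun.add_right)

lemma constraint_expansion: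
  assumes "c (xu ps) = 0"
  shows "ord 2 (\<lambda>w. c (xu (p w)) + jac_x c (xu (p w)) *v dx w + du w v* A_mat c (p w))"
proof (rule ord_cong[OF ord_minus[OF ord_linear[OF bounded_linear_compose[OF bounded_linear_fst bounded_linear_snd]
          taylor_stage(1)]]], rule eventually_mono[OF in_S])
  fix w assume w: "xu (p w) \<in> S"
  show "c (xu (p w)) + jac_x c (xu (p w)) *v dx w + du w v* A_mat c (p w)
    = - (fst (snd ((l (xu ps), c (xu ps), f (xu ps)) - (l (xu (p w)), c (xu (p w)), f (xu (p w)))
     - D (xu (p w)) (dx w, du w))))"
    by (simp add: A_mat_def vector_transpose_matrix jac_f_c[OF w] assms flip: split_arg[of _ "dx w" "du w"])
qed

lemma dynamics_expansion:
  "ord 2 (\<lambda>w. f (xu ps) - f (xu (p w)) - jac_x f (xu (p w)) *v dx w - jac_u f (xu (p w)) *v du w)"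
proof (rule ord_cong[OF ord_linear[OF bounded_linear_compose[OF bounded_linear_snd bounded_linear_snd]
          taylor_stage(1)]], rule eventually_mono[OF in_S])
  fix w assume w: "xu (p w) \<in> S"
  show "f (xu ps) - f (xu (p w)) - jac_x f (xu (p w)) *v dx w - jac_u f (xu (p w)) *v du w
    = (snd (snd ((l (xu ps), c (xu ps), f (xu ps)) - (l (xu (p w)), c (xu (p w)), f (xu (p w)))
     - D (xu (p w)) (dx w, du w))))"
    by (simp add: jac_f_c[OF w] flip: split_arg[of _ "dx w" "du w"])
qed

text \<open>The second-derivative term carries the weights of the iterate instead of the optimal
  ones. Their difference is of first order and multiplies a second derivative applied to a
  first-order displacement; this is why first-order accuracy of \<open>lam\<close> is
  enough.\<close>

lemma weight_expansion:
  assumes "near lam ls"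
  shows "ord 2 (\<lambda>w. (1, mult ps, ls) \<bullet> D (xu (p w)) a
     + (1, mult (p w), lam w) \<bullet> D2 (xu (p w)) (dx w, du w) a - (1, mult ps, ls) \<bullet> D (xu ps) a)"
proof -
  have 1: "ord 2 (\<lambda>w. (1, mult ps, ls) \<bullet> (D (xu ps) - D (xu (p w)) - D2 (xu (p w)) (dx w, du w)) a)"
    by (rule ord_linear[OF bounded_linear_inner_right
          ord_linear[OF blinfun.bounded_linear_left taylor_stage(2)]])
  have "ord 1 (\<lambda>w. D2 (xu (p w)) (xu (p w) - xu ps))"
    by (rule ord_bilinear'[OF blinfun.bounded_bilinear_axioms near_ord0[OF near_D2] near_xu[unfolded near_def]]) simp
  then have "ord 1 (\<lambda>w. D2 (xu (p w)) (dx w, du w))"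
    unfolding xu_diff[symmetric] using ord_minus by (force simp flip: blinfun.minus_right)
  then have 2: "ord 2 (\<lambda>w. ((1, mult (p w), lam w) - (1, mult ps, ls)) \<bullet> D2 (xu (p w)) (dx w, du w) a)"
    by (intro ord_bilinear'[OF bounded_bilinear_inner near_weight[OF assms, unfolded near_def]
          ord_linear[OF blinfun.bounded_linear_left]]) auto
  show ?thesis
    by (rule ord_cong[OF ord_diff[OF 2 1]]) (simp add: blinfun.diff_left inner_diff_left inner_diff_right del: diff_Pair)
qed

text \<open>The gradient of the Lagrangian is linear in its multiplier, so passing from the optimal
  multiplier to that of the iterate produces exactly the term with \<open>dphi\<close>.\<close>

lemma stationarity_u_expansion:
  assumes "near lam ls" and "Qu_vec l f c ps ls = 0"
  shows "ord 2 (\<lambda>w. grad_u (lagrangian l c (mult (p w))) (xu (p w)) + ls v* jac_u f (xu (p w))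
     + H_mat l f c (p w) (lam w) 0 *v du w + B_mat l f c (p w) (lam w) 0 *v dx w + A_mat c (p w) *v dphi w)"
proof (rule ord_vecI, rule ord_cong[OF weight_expansion[OF assms(1)]], rule eventually_mono[OF in_S])
  fix i w assume w: "xu (p w) \<in> S"
  have "(A_mat c (p w) *v dphi w) $ i = dphi w \<bullet> fst (snd (D (xu (p w)) (0, axis i 1)))"
    by (simp add: A_mat_def vector_matrix_mult_nth jac_f_c[OF w])
  moreover have "dphi w \<bullet> fst (snd X) = (1, mult ps, ls) \<bullet> X - (1, mult (p w), ls) \<bullet> X"
    for X :: "real \<times> (real^'c) \<times> (real^'x)"
    by (cases X) (simp add: dphi_def inner_diff_left)
  moreover have "(1, mult ps, ls) \<bullet> D (xu ps) (0, axis i 1) = 0"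
    using assms(2) Q_vec_nth(2)[OF ps_in_S, of ls i] by simp
  ultimately show "(grad_u (lagrangian l c (mult (p w))) (xu (p w)) + ls v* jac_u f (xu (p w))
     + H_mat l f c (p w) (lam w) 0 *v du w + B_mat l f c (p w) (lam w) 0 *v dx w + A_mat c (p w) *v dphi w) $ i
     = (1, mult ps, ls) \<bullet> D (xu (p w)) (0, axis i 1)
     + (1, mult (p w), lam w) \<bullet> D2 (xu (p w)) (dx w, du w) (0, axis i 1) - (1, mult ps, ls) \<bullet> D (xu ps) (0, axis i 1)"
    unfolding Qu_vec_def[symmetric]
    by (simp add: Q_vec_nth[OF w] Q_mat_apply[OF w] inner_add_right blinfun.add_left flip: split_arg[of _ "dx w" "du w"])
qed

lemma stationarity_x_expansion:
  assumes "near lam ls" and "Qx_vec l f c ps ls = ls'"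
  shows "ord 2 (\<lambda>w. grad_x (lagrangian l c (mult (p w))) (xu (p w)) + ls v* jac_x f (xu (p w))
     + C_mat l f c (p w) (lam w) 0 *v dx w + du w v* B_mat l f c (p w) (lam w) 0
     + dphi w v* jac_x c (xu (p w)) - ls')"
proof (rule ord_vecI, rule ord_cong[OF weight_expansion[OF assms(1)]], rule eventually_mono[OF in_S])
  fix i w assume w: "xu (p w) \<in> S"
  have "(dphi w v* jac_x c (xu (p w))) $ i = dphi w \<bullet> fst (snd (D (xu (p w)) (axis i 1, 0)))"
    by (simp add: vector_matrix_mult_nth jac_f_c[OF w])
  moreover have "dphi w \<bullet> fst (snd X) = (1, mult ps, ls) \<bullet> X - (1, mult (p w), ls) \<bullet> X"
    for X :: "real \<times> (real^'c) \<times> (real^'x)"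
    by (cases X) (simp add: dphi_def inner_diff_left)
  moreover have "(1, mult ps, ls) \<bullet> D (xu ps) (axis i 1, 0) = ls' $ i"
    using assms(2) Q_vec_nth(1)[OF ps_in_S, of ls i] by simp
  ultimately show "(grad_x (lagrangian l c (mult (p w))) (xu (p w)) + ls v* jac_x f (xu (p w))
     + C_mat l f c (p w) (lam w) 0 *v dx w + du w v* B_mat l f c (p w) (lam w) 0
     + dphi w v* jac_x c (xu (p w)) - ls') $ i
     = (1, mult ps, ls) \<bullet> D (xu (p w)) (axis i 1, 0)
     + (1, mult (p w), lam w) \<bullet> D2 (xu (p w)) (dx w, du w) (axis i 1, 0) - (1, mult ps, ls) \<bullet> D (xu ps) (axis i 1, 0)"
    unfolding Qx_vec_def[symmetric]
    by (simp add: Q_vec_nth[OF w] Q_mat_apply[OF w] B_mat_transpose_nth[OF w] inner_add_right blinfun.add_left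
        flip: split_arg[of _ "dx w" "du w"])
qed

end

definition kkt_regular :: "real^'u^'u \<Rightarrow> real^'c^'u \<Rightarrow> bool" where
  "kkt_regular H A \<longleftrightarrow> (\<forall>\<xi> \<eta>. H *v \<xi> + A *v \<eta> = 0 \<longrightarrow> transpose A *v \<xi> = 0 \<longrightarrow> \<xi> = 0 \<and> \<eta> = 0)"

lemma kkt_solution_gains:
  assumes "kkt_regular (H_mat l f c p lam P) (A_mat c p)"
  shows "kkt_solution (H_mat l f c p lam P) (A_mat c p) (Qu_vec l f c p V)
           (B_mat l f c p lam P) (c (xu p)) (jac_x c (xu p)) (gains l f c p (lam, V, P))"
  unfolding gains_def prod.case
  by (rule someI_ex, rule kkt_solution_exists) (use assms in \<open>auto simp: kkt_regular_def\<close>)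

lemma backward_step_eq:
  fixes l f c p lam V P
  defines "g \<equiv> gains l f c p (lam, V, P)"
  defines "H \<equiv> H_mat l f c p lam P" and "B \<equiv> B_mat l f c p lam P"
  shows "fst (backward_step l f c p (lam, V, P)) = Qx_vec l f c p lam"
    and "fst (snd (backward_step l f c p (lam, V, P)))
      = Qx_vec l f c p V + Qu_vec l f c p V v* fst (snd g) + c (xu p) v* snd (snd (snd g))"
    and "snd (snd (backward_step l f c p (lam, V, P)))
      = C_mat l f c p lam P + transpose (fst (snd g)) ** H ** fst (snd g)
        + transpose B ** fst (snd g) + transpose (fst (snd g)) ** B"
  unfolding backward_step_def g_def H_def B_def
  by (simp_all add: Let_def Qx_vec_def split: prod.split)

context ocp_stage
begin

text \<open>Both multiplier slots of \<open>bs\<close> hold \<open>ls\<close>: where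
  \<open>Qu\<close> and the constraint vanish, the recursion for \<open>V\<close> collapses to that
  for \<open>lam\<close>. The invariant \<open>inv\<close> uses the increment of \<open>f\<close> in
  place of the next state displacement, so the stage can be treated without reference to its
  neighbours.\<close>

lemma stage_step:
  fixes lam V :: "'w \<Rightarrow> real^'x" and P :: "'w \<Rightarrow> real^'x^'x" and ls ls' Ps
  defines "b \<equiv> \<lambda>w. backward_step l f c (p w) (lam w, V w, P w)"
    and "g \<equiv> \<lambda>w. gains l f c (p w) (lam w, V w, P w)"
    and "bs \<equiv> backward_step l f c ps (ls, ls, Ps)"
  assumes lam: "near lam ls" and V: "near V ls" and P: "near P Ps"
    and sym: "\<forall>\<^sub>F w in F. transpose (P w) = P w"
    and inv: "ord 2 (\<lambda>w. V w + P w *v (f (xu ps) - f (xu (p w))) - ls)"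
    and Qu: "Qu_vec l f c ps ls = 0" and Qx: "Qx_vec l f c ps ls = ls'" and c0: "c (xu ps) = 0"
    and reg: "\<forall>\<^sub>F w in F. kkt_regular (H_mat l f c (p w) (lam w) (P w)) (A_mat c (p w))"
    and reg0: "kkt_regular (H_mat l f c ps ls Ps) (A_mat c ps)"
  shows "fst bs = ls'" "fst (snd bs) = ls'"
    and "near (\<lambda>w. fst (b w)) ls'" "near (\<lambda>w. fst (snd (b w))) ls'"
    and "near (\<lambda>w. snd (snd (b w))) (snd (snd bs))"
    and "\<forall>\<^sub>F w in F. transpose (snd (snd (b w))) = snd (snd (b w))"
    and "ord 2 (\<lambda>w. fst (snd (b w)) + snd (snd (b w)) *v dx w - ls')"
    and "ord 2 (\<lambda>w. fst (g w) + fst (snd (g w)) *v dx w - du w)"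
    and "ord 2 (\<lambda>w. fst (snd (snd (g w))) + snd (snd (snd (g w))) *v dx w - dphi w)"
    and "ord 0 (\<lambda>w. fst (snd (g w)))" "ord 0 (\<lambda>w. snd (snd (snd (g w))))"
proof -
  define gs where "gs = gains l f c ps (ls, ls, Ps)"
  define H where "H w = H_mat l f c (p w) (lam w) (P w)" for w
  define B where "B w = B_mat l f c (p w) (lam w) (P w)" for w
  define C where "C w = C_mat l f c (p w) (lam w) (P w)" for w
  have near_HBC: "near H (H_mat l f c ps ls Ps)" "near B (B_mat l f c ps ls Ps)" "near C (C_mat l f c ps ls Ps)"
    unfolding H_def B_def C_def by (rule near_Q_mat[OF lam P])+
  have near_c: "near (\<lambda>w. c (xu (p w))) (c (xu ps))"
    by (rule near_differentiable[OF _ near_xu])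
      (use has_derivative_fst[OF has_derivative_snd[OF D[OF ps_in_S]]] in simp)
  have sol: "\<forall>\<^sub>F w in F. kkt_solution (H w) (A_mat c (p w)) (Qu_vec l f c (p w) (V w)) (B w)
      (c (xu (p w))) (jac_x c (xu (p w)))
      (fst (g w), fst (snd (g w)), fst (snd (snd (g w))), snd (snd (snd (g w))))"
    using reg unfolding H_def B_def g_def
    by eventually_elim (simp add: kkt_solution_gains)
  have sol0: "kkt_solution (H_mat l f c ps ls Ps) (A_mat c ps) (Qu_vec l f c ps ls) (B_mat l f c ps ls Ps)
      (c (xu ps)) (jac_x c (xu ps)) (fst gs, fst (snd gs), fst (snd (snd gs)), snd (snd (snd gs)))"
    using kkt_solution_gains[OF reg0, of ls] by (simp add: gs_def)
  have near_\<beta>: "near (\<lambda>w. fst (snd (g w))) (fst (snd gs))"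
    and near_\<omega>: "near (\<lambda>w. snd (snd (snd (g w)))) (snd (snd (snd gs)))"
    using near_gains(2,4)[OF near_HBC(1) near_A near_Q_vec(2)[OF V] near_HBC(2) near_c near_jac(3) _ sol sol0]
      reg0 unfolding kkt_regular_def by blast+
  then show "ord 0 (\<lambda>w. fst (snd (g w)))" "ord 0 (\<lambda>w. snd (snd (snd (g w))))"
    by (auto intro: near_ord0)
  show "fst bs = ls'" "fst (snd bs) = ls'"
    unfolding bs_def backward_step_eq by (simp_all add: Qx Qu c0)
  show "near (\<lambda>w. fst (b w)) ls'"
    unfolding b_def backward_step_eq Qx[symmetric] by (rule near_Q_vec(1)[OF lam])
  have "near (\<lambda>w. fst (snd (b w))) (Qx_vec l f c ps ls + Qu_vec l f c ps ls v* fst (snd gs)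
      + c (xu ps) v* snd (snd (snd gs)))"
    unfolding b_def backward_step_eq g_def[symmetric]
    by (intro near_add near_bilinear[OF bounded_bilinear_vector_matrix_mul] near_Q_vec V near_c
        near_\<beta>[unfolded g_def] near_\<omega>[unfolded g_def])
  then show "near (\<lambda>w. fst (snd (b w))) ls'"
    by (simp add: Qx Qu c0)
  have b_P: "snd (snd (b w)) = C w + transpose (fst (snd (g w))) ** H w ** fst (snd (g w))
      + transpose (B w) ** fst (snd (g w)) + transpose (fst (snd (g w))) ** B w" for w
    by (simp add: b_def backward_step_eq g_def C_def H_def B_def)
  show "near (\<lambda>w. snd (snd (b w))) (snd (snd bs))"
    unfolding b_P bs_def backward_step_eq gs_def[symmetric]
    by (intro near_add near_sandwich near_bilinear[OF bounded_bilinear_matrix_mul]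
        near_linear[OF bounded_linear_transpose] near_HBC near_\<beta>)
  have symHP: "\<forall>\<^sub>F w in F. transpose (H w) = H w \<and> transpose (C w) = C w \<and> transpose (P w) = P w"
    using sym in_S unfolding H_def C_def by eventually_elim (auto intro: Q_mat_symmetric)
  then show "\<forall>\<^sub>F w in F. transpose (snd (snd (b w))) = snd (snd (b w))"
    by eventually_elim (simp add: b_P transpose_add symmetric_sandwich matrix_transpose_mul transpose_transpose matrix_mul_assoc add_ac)
  have sol': "\<forall>\<^sub>F w in F. transpose (H w) = H w \<and> transpose (P w) = P w \<and>
      kkt_solution (H w) (A_mat c (p w))
        (grad_u (lagrangian l c (mult (p w))) (xu (p w)) + V w v* jac_u f (xu (p w))) (B w)
        (c (xu (p w))) (jac_x c (xu (p w)))
        (fst (g w), fst (snd (g w)), fst (snd (snd (g w))), snd (snd (snd (g w))))"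
    using symHP sol by eventually_elim (simp add: Qu_vec_def)
  have inj: "H_mat l f c ps ls Ps *v \<xi> + A_mat c ps *v \<eta> = 0 \<Longrightarrow> transpose (A_mat c ps) *v \<xi> = 0 \<Longrightarrow> \<xi> = 0 \<and> \<eta> = 0"
    for \<xi> \<eta> using reg0 unfolding kkt_regular_def by blast
  have split:
    "\<And>w. H w = H_mat l f c (p w) (lam w) 0 + transpose (jac_u f (xu (p w))) ** P w ** jac_u f (xu (p w))"
    "\<And>w. B w = B_mat l f c (p w) (lam w) 0 + transpose (jac_u f (xu (p w))) ** P w ** jac_x f (xu (p w))"
    "\<And>w. C w = C_mat l f c (p w) (lam w) 0 + transpose (jac_x f (xu (p w))) ** P w ** jac_x f (xu (p w))"
    unfolding H_def B_def C_def by (rule Q_mat_split)+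
  note err = stage_error[OF constraint_expansion[OF c0] dynamics_expansion inv
      stationarity_u_expansion[OF lam Qu] stationarity_x_expansion[OF lam Qx]
      near_HBC(1) near_A near_HBC(2) near_jac(3) near_jac(1) near_jac(2) P _ split sol']
  show "ord 2 (\<lambda>w. fst (g w) + fst (snd (g w)) *v dx w - du w)"
    by (rule err(1)) (use inj in blast)
  show "ord 2 (\<lambda>w. fst (snd (snd (g w))) + snd (snd (snd (g w))) *v dx w - dphi w)"
    by (rule err(2)) (use inj in blast)
  show "ord 2 (\<lambda>w. fst (snd (b w)) + snd (snd (b w)) *v dx w - ls')"
    unfolding b_P unfolding b_def backward_step_eq g_def[symmetric] Qx_vec_def Qu_vec_def
    using err(3) inj unfolding g_def by blast
qed

end

section \<open>Lipschitz derivatives under linear maps, sums and pairing\<close>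

lemma lipschitz_on_blinfun_compose:
  fixes Z :: "'d::real_normed_vector \<Rightarrow>\<^sub>L 'e::real_normed_vector"
    and h :: "'a::metric_space \<Rightarrow> 'f::real_normed_vector \<Rightarrow>\<^sub>L 'd"
  assumes h: "K-lipschitz_on S h"
  shows "(norm Z * K)-lipschitz_on S (\<lambda>z. Z o\<^sub>L h z)"
proof (rule lipschitz_onI)
  show "0 \<le> norm Z * K"
    using lipschitz_on_nonneg[OF h] by simp
  fix x y assume "x \<in> S" "y \<in> S"
  have "norm ((Z o\<^sub>L h x) - (Z o\<^sub>L h y)) \<le> norm Z * norm (h x - h y)"
    using norm_blinfun_compose[of Z "h x - h y"]
    by (simp add: bounded_bilinear.diff_right[OF bounded_bilinear_blinfun_compose])
  also have "\<dots> \<le> norm Z * (K * dist x y)"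
    using lipschitz_onD[OF h \<open>x \<in> S\<close> \<open>y \<in> S\<close>] by (simp add: mult_left_mono dist_norm[of "h x"])
  finally show "dist (Z o\<^sub>L h x) (Z o\<^sub>L h y) \<le> norm Z * K * dist x y"
    by (simp add: dist_norm mult.assoc)
qed

lemma lipschitz_derivs_on_linear:
  fixes g :: "'a::real_normed_vector \<Rightarrow> 'b::real_normed_vector" and T :: "'b \<Rightarrow> 'c::real_normed_vector"
  assumes "bounded_linear T" and "lipschitz_derivs_on S g"
  shows "lipschitz_derivs_on S (\<lambda>z. T (g z))"
proof -
  obtain g' g'' K K' where g: "\<And>z. z \<in> S \<Longrightarrow> (g has_derivative blinfun_apply (g' z)) (at z)"
    "\<And>z. z \<in> S \<Longrightarrow> (g' has_derivative blinfun_apply (g'' z)) (at z)"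
    "K-lipschitz_on S g'" "K'-lipschitz_on S g''"
    using assms(2) unfolding lipschitz_derivs_on_def by blast
  define U where "U = Blinfun T"
  have U: "blinfun_apply U = T"
    unfolding U_def by (rule bounded_linear_Blinfun_apply[OF assms(1)])
  \<comment> \<open>Composition with \<open>T\<close> acts linearly on first derivatives too;
    \<open>W\<close> is that action, so the second derivative is \<open>W\<close> composed with
    \<open>g''\<close>.\<close>
  define W where "W = Blinfun (\<lambda>X :: 'a \<Rightarrow>\<^sub>L 'b. U o\<^sub>L X)"
  have W: "blinfun_apply W = (\<lambda>X. U o\<^sub>L X)"
    unfolding W_def by (rule bounded_linear_Blinfun_apply[OF
          bounded_bilinear.bounded_linear_right[OF bounded_bilinear_blinfun_compose]])
  have "(\<forall>z\<in>S. ((\<lambda>z. T (g z)) has_derivative blinfun_apply (U o\<^sub>L g' z)) (at z)) \<and>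
      (\<forall>z\<in>S. ((\<lambda>z. U o\<^sub>L g' z) has_derivative blinfun_apply (W o\<^sub>L g'' z)) (at z))"
  proof (intro conjI ballI)
    fix z assume z: "z \<in> S"
    show "((\<lambda>z. T (g z)) has_derivative blinfun_apply (U o\<^sub>L g' z)) (at z)"
      using bounded_linear.has_derivative[OF assms(1) g(1)[OF z]]
      by (simp add: U blinfun_apply_blinfun_compose[abs_def] o_def)
    show "((\<lambda>z. U o\<^sub>L g' z) has_derivative blinfun_apply (W o\<^sub>L g'' z)) (at z)"
      using bounded_linear.has_derivative[OF blinfun.bounded_linear_right[of W] g(2)[OF z]]
      by (simp add: W blinfun_apply_blinfun_compose[abs_def] o_def)
  qed
  then show ?thesis
    unfolding lipschitz_derivs_on_def
    using lipschitz_on_blinfun_compose[OF g(3), of U] lipschitz_on_blinfun_compose[OF g(4), of W]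
    by (intro exI[of _ "\<lambda>z. U o\<^sub>L g' z"] exI[of _ "\<lambda>z. W o\<^sub>L g'' z"]) auto
qed

lemma lipschitz_derivs_on_add:
  assumes "lipschitz_derivs_on S g" and "lipschitz_derivs_on S h"
  shows "lipschitz_derivs_on S (\<lambda>z. g z + h z)"
proof -
  obtain g' g'' K K' where g: "\<And>z. z \<in> S \<Longrightarrow> (g has_derivative blinfun_apply (g' z)) (at z)"
    "\<And>z. z \<in> S \<Longrightarrow> (g' has_derivative blinfun_apply (g'' z)) (at z)"
    "K-lipschitz_on S g'" "K'-lipschitz_on S g''"
    using assms(1) unfolding lipschitz_derivs_on_def by blast
  obtain h' h'' L L' where h: "\<And>z. z \<in> S \<Longrightarrow> (h has_derivative blinfun_apply (h' z)) (at z)"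
    "\<And>z. z \<in> S \<Longrightarrow> (h' has_derivative blinfun_apply (h'' z)) (at z)"
    "L-lipschitz_on S h'" "L'-lipschitz_on S h''"
    using assms(2) unfolding lipschitz_derivs_on_def by blast
  have "\<forall>z\<in>S. ((\<lambda>z. g z + h z) has_derivative blinfun_apply (g' z + h' z)) (at z)"
    "\<forall>z\<in>S. ((\<lambda>z. g' z + h' z) has_derivative blinfun_apply (g'' z + h'' z)) (at z)"
    using has_derivative_add[OF g(1) h(1)] has_derivative_add[OF g(2) h(2)]
    by (simp_all add: plus_blinfun.rep_eq)
  then show ?thesis
    unfolding lipschitz_derivs_on_def
    using lipschitz_on_add[OF g(3) h(3)] lipschitz_on_add[OF g(4) h(4)]
    by (intro exI[of _ "\<lambda>z. g' z + h' z"] exI[of _ "\<lambda>z. g'' z + h'' z"]) auto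
qed

lemma lipschitz_derivs_on_Pair:
  assumes "lipschitz_derivs_on S g" and "lipschitz_derivs_on S h"
  shows "lipschitz_derivs_on S (\<lambda>z. (g z, h z))"
proof -
  have "bounded_linear (\<lambda>x. (x, 0))" "bounded_linear (\<lambda>y. (0, y))"
    by (intro bounded_linear_Pair bounded_linear_ident bounded_linear_zero)+
  from lipschitz_derivs_on_add[OF lipschitz_derivs_on_linear[OF this(1) assms(1)]
      lipschitz_derivs_on_linear[OF this(2) assms(2)]]
  show ?thesis by simp
qed

lemma ocp_derivatives_exist:
  assumes "open S" "convex S"
    and "lipschitz_derivs_on S l" "lipschitz_derivs_on S f" "lipschitz_derivs_on S c"
  obtains D D2 K where "ocp_derivatives l f c S D D2 K"
proof -
  have "lipschitz_derivs_on S (\<lambda>z. (l z, c z, f z))"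
    by (intro lipschitz_derivs_on_Pair assms)
  then obtain D D2 K K' where "\<forall>z\<in>S. ((\<lambda>z. (l z, c z, f z)) has_derivative blinfun_apply (D z)) (at z)"
    "\<forall>z\<in>S. (D has_derivative blinfun_apply (D2 z)) (at z)"
    "K-lipschitz_on S D" "K'-lipschitz_on S D2"
    unfolding lipschitz_derivs_on_def by blast
  moreover from this have "(max K K')-lipschitz_on S D" "(max K K')-lipschitz_on S D2"
    by (auto intro: lipschitz_on_mono)
  ultimately have "ocp_derivatives l f c S D D2 (max K K')"
    using assms by unfold_locales auto
  then show ?thesis by (rule that)
qed

section \<open>Convergence\<close>

text \<open>Smoothness is assumed on the projections of the neighbourhoods to states and controls,
  which must inherit openness and convexity for the Taylor expansions.\<close>

lemma open_xu_image: "open S \<Longrightarrow> open (xu ` S)"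
  and convex_xu_image: "convex S \<Longrightarrow> convex (xu ` S)"
proof -
  have lin: "linear xu"
    by (intro linearI) (auto simp: xu_def)
  have "surj xu"
    unfolding surj_def xu_def by (metis fst_conv prod.collapse snd_conv)
  then show "open S \<Longrightarrow> open (xu ` S)"
    using lin by (intro open_surjective_linear_image)
  show "convex S \<Longrightarrow> convex (xu ` S)"
    using lin by (rule convex_linear_image)
qed

text \<open>The multipliers \<open>ls\<close> of the optimal point are fixed here, and the KKT
  conditions are phrased through \<open>Qx_vec\<close> and \<open>Qu_vec\<close>, that is, as the
  equations of the backward pass with \<open>ls\<close> in place of \<open>V\<close>.\<close>

locale filter_ddp =
  fixes l :: "(real^'x) \<times> (real^'u) \<Rightarrow> real"
    and f :: "(real^'x) \<times> (real^'u) \<Rightarrow> real^'x"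
    and c :: "(real^'x) \<times> (real^'u) \<Rightarrow> real^'c"
    and N :: nat
    and x1 :: "real^'x"
    and wstar :: "nat \<Rightarrow> (real^'x) \<times> (real^'u) \<times> (real^'c)"
    and NN :: "nat \<Rightarrow> ((real^'x) \<times> (real^'u) \<times> (real^'c)) set"
    and ls :: "nat \<Rightarrow> real^'x"
  assumes nbhd: "t \<in> {1..N} \<Longrightarrow> open (NN t) \<and> convex (NN t) \<and> wstar t \<in> NN t"
    and smooth: "t \<in> {1..N} \<Longrightarrow> lipschitz_derivs_on (xu ` NN t) l \<and>
      lipschitz_derivs_on (xu ` NN t) f \<and> lipschitz_derivs_on (xu ` NN t) c"
    and full_rank: "t \<in> {1..N} \<Longrightarrow> q \<in> NN t \<Longrightarrow> 0 < min_singular_value (A_mat c q)"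
    and pos_def: "\<forall>t\<in>{1..N}. w t \<in> NN t \<Longrightarrow> t \<in> {1..N} \<Longrightarrow> \<xi> \<noteq> 0 \<Longrightarrow>
      transpose (A_mat c (w t)) *v \<xi> = 0 \<Longrightarrow> \<xi> \<bullet> (H_at l f c N w t *v \<xi>) > 0"
    and ls_end: "ls (Suc N) = 0"
    and stationary_x: "t \<in> {1..N} \<Longrightarrow> Qx_vec l f c (wstar t) (ls (Suc t)) = ls t"
    and stationary_u: "t \<in> {1..N} \<Longrightarrow> Qu_vec l f c (wstar t) (ls (Suc t)) = 0"
    and constraint: "t \<in> {1..N} \<Longrightarrow> c (xu (wstar t)) = 0"
    and dynamics: "feasible_dyn f N x1 (\<lambda>t. xu (wstar t))"
begin

definition iterates :: "(nat \<Rightarrow> (real^'x) \<times> (real^'u) \<times> (real^'c)) set" where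
  "iterates = {w. (\<forall>t\<in>{1..N}. w t \<in> NN t) \<and> feasible_dyn f N x1 (\<lambda>t. xu (w t))}"

text \<open>Neighbourhoods of 0 are pulled back along the distance, because trajectories are
  functions on all of \<open>nat\<close> and only the times from 1 to \<open>N\<close>
  count.\<close>

definition nearby :: "(nat \<Rightarrow> (real^'x) \<times> (real^'u) \<times> (real^'c)) filter" where
  "nearby = inf (filtercomap (traj_dist N wstar) (nhds 0)) (principal iterates)"

lemma eventually_nearby_iterates: "\<forall>\<^sub>F w in nearby. w \<in> iterates"
  unfolding nearby_def by (simp add: eventually_inf_principal)

lemma eventually_nearbyD:
  assumes "\<forall>\<^sub>F w in nearby. Q w"
  shows "\<exists>r>0. \<forall>w\<in>iterates. traj_dist N wstar w < r \<longrightarrow> Q w"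
proof -
  obtain R where R: "eventually R (nhds 0)" "\<And>w. R (traj_dist N wstar w) \<Longrightarrow> w \<in> iterates \<Longrightarrow> Q w"
    using assms unfolding nearby_def eventually_inf_principal eventually_filtercomap by blast
  obtain r where r: "r > 0" "\<And>y. dist y 0 < r \<Longrightarrow> R y"
    using R(1) unfolding eventually_nhds_metric by blast
  have "Q w" if "w \<in> iterates" "traj_dist N wstar w < r" for w
    using that by (intro R(2) r(2)) (simp_all add: traj_dist_def L2_set_nonneg)
  with r(1) show ?thesis by blast
qed

sublocale small_error nearby "traj_dist N wstar"
proof
  show "0 \<le> traj_dist N wstar w" for w
    by (simp add: traj_dist_def L2_set_nonneg)
  show "(traj_dist N wstar \<longlongrightarrow> 0) nearby"
    unfolding nearby_def by (rule tendsto_mono[OF inf_le1 filterlim_filtercomap])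
qed

lemma near_iterate:
  assumes "t \<in> {1..N}"
  shows "near (\<lambda>w. w t) (wstar t)"
  unfolding near_def
proof (rule ordI[where M = 1], rule always_eventually, rule allI)
  fix w :: "nat \<Rightarrow> (real^'x) \<times> (real^'u) \<times> (real^'c)"
  show "norm (w t - wstar t) \<le> 1 * traj_dist N wstar w ^ 1"
    using member_le_L2_set[OF _ assms, of "\<lambda>t. dist (wstar t) (w t)"]
    by (simp add: traj_dist_def dist_norm norm_minus_commute)
qed

text \<open>It serves at nearby iterates, to have gains that solve the system, and at
  \<open>wstar\<close>, to have an invertible limit. Since \<open>lam\<close> and \<open>P\<close>
  come from the backward pass at the same trajectory, the limit of \<open>P\<close> has to be
  \<open>P_at wstar\<close>.\<close>

lemma regular:
  assumes "\<forall>t\<in>{1..N}. w t \<in> NN t" and t: "t \<in> {1..N}" and "backward l f c N w (Suc t) = (lam, V, P)"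
  shows "kkt_regular (H_mat l f c (w t) lam P) (A_mat c (w t))"
proof -
  have "H_at l f c N w t = H_mat l f c (w t) lam P"
    by (simp add: H_at_def assms(3))
  then have pos: "\<xi> \<bullet> (H_mat l f c (w t) lam P *v \<xi>) > 0"
    if "\<xi> \<noteq> 0" "transpose (A_mat c (w t)) *v \<xi> = 0" for \<xi>
    using pos_def[OF assms(1) t that] by simp
  have "0 < min_singular_value (A_mat c (w t))"
    using assms(1) t by (intro full_rank) auto
  then have inj: "\<eta> = 0" if "A_mat c (w t) *v \<eta> = 0" for \<eta>
    using that by (rule injective_if_min_singular_value_pos)
  show ?thesis
    unfolding kkt_regular_def
  proof (intro allI impI)
    fix \<xi> \<eta>
    assume eq: "H_mat l f c (w t) lam P *v \<xi> + A_mat c (w t) *v \<eta> = 0" "transpose (A_mat c (w t)) *v \<xi> = 0"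
    show "\<xi> = 0 \<and> \<eta> = 0"
      by (rule kkt_injective[OF _ _ eq]) (simp_all add: pos inj)
  qed
qed

abbreviation lam_at where "lam_at w t \<equiv> fst (backward l f c N w t)"
abbreviation V_at where "V_at w t \<equiv> fst (snd (backward l f c N w t))"
abbreviation P_at where "P_at w t \<equiv> snd (snd (backward l f c N w t))"

text \<open>
  The last clause is the key invariant: \<open>V + P (x\<^sup>* - x)\<close> is the optimal multiplier up to second order.
\<close>
definition backward_close :: "nat \<Rightarrow> bool" where
  "backward_close t \<longleftrightarrow> lam_at wstar t = ls t \<and> V_at wstar t = ls t \<and>
     near (\<lambda>w. lam_at w t) (ls t) \<and> near (\<lambda>w. V_at w t) (ls t) \<and>
     near (\<lambda>w. P_at w t) (P_at wstar t) \<and>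
     (\<forall>\<^sub>F w in nearby. transpose (P_at w t) = P_at w t) \<and>
     ord 2 (\<lambda>w. V_at w t + P_at w t *v (if t \<le> N then fst (wstar t) - fst (w t) else 0) - ls t)"

definition gains_close :: "nat \<Rightarrow> bool" where
  "gains_close t \<longleftrightarrow>
     ord 2 (\<lambda>w. fst (gains_at l f c N w t) + fst (snd (gains_at l f c N w t)) *v (fst (wstar t) - fst (w t))
       - (fst (snd (wstar t)) - fst (snd (w t)))) \<and>
     ord 2 (\<lambda>w. fst (snd (snd (gains_at l f c N w t)))
       + snd (snd (snd (gains_at l f c N w t))) *v (fst (wstar t) - fst (w t)) - (mult (wstar t) - mult (w t))) \<and>
     ord 0 (\<lambda>w. fst (snd (gains_at l f c N w t))) \<and> ord 0 (\<lambda>w. snd (snd (snd (gains_at l f c N w t))))"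

lemma stage_exists:
  assumes t: "t \<in> {1..N}"
  obtains D D2 K where
    "ocp_stage nearby (traj_dist N wstar) l f c (xu ` NN t) D D2 K (\<lambda>w. w t) (wstar t)"
proof -
  obtain D D2 K where "ocp_derivatives l f c (xu ` NN t) D D2 K"
    using ocp_derivatives_exist[of "xu ` NN t" l f c] smooth[OF t] nbhd[OF t]
      open_xu_image convex_xu_image by metis
  then interpret ocp_derivatives l f c "xu ` NN t" D D2 K .
  have "ocp_stage nearby (traj_dist N wstar) l f c (xu ` NN t) D D2 K (\<lambda>w. w t) (wstar t)"
  proof
    show "\<forall>\<^sub>F w in nearby. xu (w t) \<in> xu ` NN t"
      using eventually_nearby_iterates by eventually_elim (use t in \<open>auto simp: iterates_def\<close>)
    show "xu (wstar t) \<in> xu ` NN t"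
      using nbhd[OF t] by blast
    show "near (\<lambda>w. w t) (wstar t)"
      using t by (rule near_iterate)
  qed
  then show ?thesis by (rule that)
qed

text \<open>Trajectories carry no meaning at \<open>N + 1\<close>; the conditional in
  \<open>backward_close\<close> sets the displacement to 0 there, and all backward quantities are 0
  as well.\<close>

lemma backward_close_end: "backward_close (Suc N)"
  by (simp add: backward_close_def backward.simps[of _ _ _ _ _ "Suc N"] ls_end
      near_const[of 0] transpose_def vec_eq_iff)

lemma backward_close_step:
  assumes t: "t \<in> {1..N}" and "backward_close (Suc t)"
  shows "backward_close t" and "gains_close t"
proof -
  obtain D D2 K where "ocp_stage nearby (traj_dist N wstar) l f c (xu ` NN t) D D2 K (\<lambda>w. w t) (wstar t)"
    using stage_exists[OF t] .
  then interpret st: ocp_stage nearby "traj_dist N wstar" l f c "xu ` NN t" D D2 K "\<lambda>w. w t" "wstar t" .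
  have eq: "(lam_at w s, V_at w s, P_at w s) = backward l f c N w s" for w s
    by simp
  have b: "backward l f c N w t = backward_step l f c (w t) (lam_at w (Suc t), V_at w (Suc t), P_at w (Suc t))" for w
    using t by (subst backward.simps) simp
  have g: "gains_at l f c N w t = gains l f c (w t) (lam_at w (Suc t), V_at w (Suc t), P_at w (Suc t))" for w
    by (simp add: gains_at_def)
  have star: "lam_at wstar (Suc t) = ls (Suc t)" "V_at wstar (Suc t) = ls (Suc t)"
    using assms(2) by (simp_all add: backward_close_def)
  have bstar: "backward l f c N wstar t = backward_step l f c (wstar t) (ls (Suc t), ls (Suc t), P_at wstar (Suc t))"
    unfolding b star ..
  \<comment> \<open>For \<open>t < N\<close> both trajectories obey the dynamics, so the increment
    of \<open>f\<close> is the next state displacement. At \<open>t = N\<close> no dynamics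
    constraint links to a later state, but \<open>V\<close>, \<open>P\<close> and \<open>ls\<close>
    vanish.\<close>
  have inv: "ord 2 (\<lambda>w. V_at w (Suc t) + P_at w (Suc t) *v (f (xu (wstar t)) - f (xu (w t))) - ls (Suc t))"
  proof (cases "t < N")
    case True
    have ev: "\<forall>\<^sub>F w in nearby. f (xu (wstar t)) - f (xu (w t)) = fst (wstar (Suc t)) - fst (w (Suc t))"
      using eventually_nearby_iterates
      by eventually_elim (use dynamics t True in \<open>simp add: iterates_def feasible_dyn_def xu_def\<close>)
    have "ord 2 (\<lambda>w. V_at w (Suc t) + P_at w (Suc t) *v (fst (wstar (Suc t)) - fst (w (Suc t))) - ls (Suc t))"
      using assms(2) True by (simp add: backward_close_def)
    then show ?thesis
      by (rule ord_cong, intro eventually_mono[OF ev]) simp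
  next
    case False
    with t have "t = N" by simp
    then show ?thesis
      by (simp add: backward.simps[of _ _ _ _ _ "Suc N"] ls_end)
  qed
  have reg: "\<forall>\<^sub>F w in nearby. kkt_regular (H_mat l f c (w t) (lam_at w (Suc t)) (P_at w (Suc t))) (A_mat c (w t))"
    using eventually_nearby_iterates
    by eventually_elim (rule regular[OF _ t eq[symmetric]], simp add: iterates_def)
  have reg0: "kkt_regular (H_mat l f c (wstar t) (ls (Suc t)) (P_at wstar (Suc t))) (A_mat c (wstar t))"
    using regular[OF _ t eq[symmetric], of wstar] nbhd unfolding star by blast
  note step = st.stage_step[OF _ _ _ _ inv stationary_u[OF t] stationary_x[OF t] constraint[OF t] reg reg0]
  have hyps: "near (\<lambda>w. lam_at w (Suc t)) (ls (Suc t))" "near (\<lambda>w. V_at w (Suc t)) (ls (Suc t))"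
     "near (\<lambda>w. P_at w (Suc t)) (P_at wstar (Suc t))"
     "\<forall>\<^sub>F w in nearby. transpose (P_at w (Suc t)) = P_at w (Suc t)"
    using assms(2) by (simp_all add: backward_close_def)
  note step' = step[OF hyps, folded b bstar g, unfolded st.dx_def st.du_def st.dphi_def]
  show "backward_close t" "gains_close t"
    unfolding backward_close_def gains_close_def using step' t by simp_all
qed

lemma backward_close:
  assumes "t \<in> {1..Suc N}"
  shows "backward_close t"
proof -
  have "t \<le> Suc N" using assms by simp
  then show ?thesis using assms
  proof (induction rule: inc_induct)
    case base
    then show ?case by (simp add: backward_close_end)
  next
    case (step n)
    then have n: "n \<in> {1..N}" and "Suc n \<in> {1..Suc N}" by auto
    then show ?case using backward_close_step(1)[OF n] step.IH by blast
  qed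
qed

lemma gains_close: "t \<in> {1..N} \<Longrightarrow> gains_close t"
  by (rule backward_close_step(2)[OF _ backward_close]) auto

text \<open>The feedback acts on the new state minus the old one. Splitting this difference at the
  optimal state leaves the stage error of \<open>gains_close\<close> plus a bounded gain times the
  error of the new state.\<close>

lemma update_close:
  assumes t: "t \<in> {1..N}" and x: "ord 2 (\<lambda>w. x w - fst (wstar t))"
  shows "ord 2 (\<lambda>w. update_at l f c N w t (x w) - wstar t)"
proof -
  let ?\<alpha> = "\<lambda>w. fst (gains_at l f c N w t)" and ?\<beta> = "\<lambda>w. fst (snd (gains_at l f c N w t))"
  let ?\<psi> = "\<lambda>w. fst (snd (snd (gains_at l f c N w t)))" and ?\<omega> = "\<lambda>w. snd (snd (snd (gains_at l f c N w t)))"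
  define du where "du w = (?\<alpha> w + ?\<beta> w *v (fst (wstar t) - fst (w t)) - (fst (snd (wstar t)) - fst (snd (w t))))
    + ?\<beta> w *v (x w - fst (wstar t))" for w
  define dphi where "dphi w = (?\<psi> w + ?\<omega> w *v (fst (wstar t) - fst (w t)) - (mult (wstar t) - mult (w t)))
    + ?\<omega> w *v (x w - fst (wstar t))" for w
  note gc = gains_close[OF t, unfolded gains_close_def]
  have "ord 2 du"
    unfolding du_def by (rule ord_add[OF _ ord_bilinear'[OF bounded_bilinear_matrix_vector_mul _ x]]) (use gc in auto)
  moreover have "ord 2 dphi"
    unfolding dphi_def by (rule ord_add[OF _ ord_bilinear'[OF bounded_bilinear_matrix_vector_mul _ x]]) (use gc in auto)
  ultimately have "ord 2 (\<lambda>w. (x w - fst (wstar t), du w, dphi w))"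
    by (intro ord_Pair x)
  moreover have "update_at l f c N w t (x w) - wstar t = (x w - fst (wstar t), du w, dphi w)" for w
    by (cases "w t", cases "wstar t")
      (simp add: update_at_def du_def dphi_def mult_def algebra_simps split: prod.split)
  ultimately show ?thesis by simp
qed

text \<open>The initial state is exact. Afterwards the second-order error of a point passes through
  \<open>f\<close>, whose differentiability at the optimal point preserves the order.\<close>

lemma forward_close:
  assumes "t \<in> {1..N}"
  shows "ord 2 (\<lambda>w. forward_state l f c N x1 w t - fst (wstar t))"
proof -
  have "1 \<le> t" using assms by simp
  then show ?thesis using assms
  proof (induction rule: dec_induct)
    case base
    then show ?case using dynamics by (simp add: feasible_dyn_def xu_def)
  next
    case (step t)
    then have t: "t \<in> {1..N}" by simp
    let ?u = "\<lambda>w. update_at l f c N w t (forward_state l f c N x1 w t)"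
    have "ord 2 (\<lambda>w. ?u w - wstar t)"
      by (rule update_close[OF t step.IH[OF t]])
    moreover have "bounded_linear (xu :: _ \<Rightarrow> (real^'x) \<times> (real^'u))"
      unfolding xu_def by (intro bounded_linear_Pair bounded_linear_fst
          bounded_linear_compose[OF bounded_linear_fst bounded_linear_snd])
    ultimately have u: "ord 2 (\<lambda>w. xu (?u w) - xu (wstar t))"
      using ord_linear[of "xu :: _ \<Rightarrow> (real^'x) \<times> (real^'u)" 2 "\<lambda>w. ?u w - wstar t"]
      by (simp add: xu_def)
    obtain f' where "(f has_derivative f') (at (xu (wstar t)))"
      using smooth[OF t] nbhd[OF t] unfolding lipschitz_derivs_on_def by blast
    from ord_differentiable[OF this u]
    have "ord 2 (\<lambda>w. f (xu (?u w)) - f (xu (wstar t)))" by simp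
    moreover have "fst (wstar (Suc t)) = f (xu (wstar t))"
      using dynamics step t by (simp add: feasible_dyn_def xu_def)
    ultimately show ?case using t by simp
  qed
qed

lemma full_step_quadratic:
  "ord 2 (\<lambda>w. traj_dist N wstar (full_step l f c N x1 w))"
proof -
  have "ord 2 (\<lambda>w. norm (full_step l f c N x1 w t - wstar t))" if "t \<in> {1..N}" for t
    unfolding full_step_def by (rule ord_norm[OF update_close[OF that forward_close[OF that]]])
  then have "ord 2 (\<lambda>w. \<Sum>t\<in>{1..N}. norm (full_step l f c N x1 w t - wstar t))"
    by (rule ord_sum)
  then show ?thesis
  proof (rule ord_le[where C = 1], intro always_eventually allI)
    fix w
    have "traj_dist N wstar (full_step l f c N x1 w) \<le> (\<Sum>t\<in>{1..N}. norm (full_step l f c N x1 w t - wstar t))"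
      unfolding traj_dist_def
      by (rule order_trans[OF L2_set_le_sum]) (simp_all add: dist_norm norm_minus_commute)
    moreover have "0 \<le> traj_dist N wstar (full_step l f c N x1 w)"
      by (simp add: traj_dist_def L2_set_nonneg)
    ultimately show "norm (traj_dist N wstar (full_step l f c N x1 w))
        \<le> 1 * norm (\<Sum>t\<in>{1..N}. norm (full_step l f c N x1 w t - wstar t))"
      by simp
  qed simp
qed

end

theorem theorem3:
  fixes l :: "(real^'x) \<times> (real^'u) \<Rightarrow> real"
    and f :: "(real^'x) \<times> (real^'u) \<Rightarrow> real^'x"
    and c :: "(real^'x) \<times> (real^'u) \<Rightarrow> real^'c"
    and N :: nat
    and x1 :: "real^'x"
    and wstar :: "nat \<Rightarrow> (real^'x) \<times> (real^'u) \<times> (real^'c)"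
    and NN :: "nat \<Rightarrow> ((real^'x) \<times> (real^'u) \<times> (real^'c)) set"
  assumes dims: "CARD('c) \<le> CARD('u)"
    and smooth: "twice_cont_diff l" "twice_cont_diff f" "twice_cont_diff c"
    and opt: "optimal_point l f c N x1 wstar"
    and nbhd: "\<forall>t\<in>{1..N}. open (NN t) \<and> convex (NN t) \<and> wstar t \<in> NN t"
    and A1: "\<forall>t\<in>{1..N}. lipschitz_derivs_on (xu ` NN t) l \<and>
               lipschitz_derivs_on (xu ` NN t) f \<and> lipschitz_derivs_on (xu ` NN t) c"
    and B1: "\<exists>\<sigma>>0. \<forall>t\<in>{1..N}. \<forall>p\<in>NN t. \<sigma> \<le> min_singular_value (A_mat c p)"
    and C1: "\<forall>w. (\<forall>t\<in>{1..N}. w t \<in> NN t) \<longrightarrow>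
               (\<forall>t\<in>{1..N}. \<forall>\<xi>. \<xi> \<noteq> 0 \<and> transpose (A_mat c (w t)) *v \<xi> = 0 \<longrightarrow>
                  \<xi> \<bullet> (H_at l f c N w t *v \<xi>) > 0)"
  shows "\<exists>\<epsilon> M. \<epsilon> > 0 \<and> M > 0 \<and>
           (\<forall>w. (\<forall>t\<in>{1..N}. w t \<in> NN t) \<and>
                feasible_dyn f N x1 (\<lambda>t. xu (w t)) \<and>
                traj_dist N wstar w < \<epsilon> \<longrightarrow>
                  traj_dist N wstar (full_step l f c N x1 w) \<le> M * (traj_dist N wstar w)\<^sup>2 \<and>
                  ((\<exists>t\<in>{1..N}. w t \<noteq> wstar t) \<longrightarrow>
                     traj_dist N wstar (full_step l f c N x1 w) < traj_dist N wstar w))"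
proof -
  obtain lam where lam: "lam (Suc N) = 0"
    "\<And>t. t \<in> {1..N} \<Longrightarrow> grad_x (lagrangian l c (mult (wstar t))) (xu (wstar t)) - lam t
        + lam (Suc t) v* jac_x f (xu (wstar t)) = 0"
    "\<And>t. t \<in> {1..N} \<Longrightarrow> grad_u (lagrangian l c (mult (wstar t))) (xu (wstar t))
        + lam (Suc t) v* jac_u f (xu (wstar t)) = 0"
    "\<And>t. t \<in> {1..N} \<Longrightarrow> c (xu (wstar t)) = 0" "feasible_dyn f N x1 (\<lambda>t. xu (wstar t))"
    using opt unfolding optimal_point_def by blast
  interpret filter_ddp l f c N x1 wstar NN lam
  proof
    show "0 < min_singular_value (A_mat c q)" if "t \<in> {1..N}" "q \<in> NN t" for t q
      using B1 that by (meson less_le_trans)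
    show "Qx_vec l f c (wstar t) (lam (Suc t)) = lam t" if "t \<in> {1..N}" for t
      using lam(2)[OF that] by (simp add: Qx_vec_def algebra_simps)
    show "Qu_vec l f c (wstar t) (lam (Suc t)) = 0" if "t \<in> {1..N}" for t
      using lam(3)[OF that] by (simp add: Qu_vec_def)
  qed (use nbhd A1 C1 lam in auto)
  let ?d = "traj_dist N wstar" and ?step = "full_step l f c N x1"
  obtain M where M: "M > 0" "\<forall>\<^sub>F w in nearby. norm (?d (?step w)) \<le> M * ?d w ^ 2"
    using full_step_quadratic by (rule ordE)
  obtain r where r: "r > 0" "\<forall>w\<in>iterates. ?d w < r \<longrightarrow> norm (?d (?step w)) \<le> M * ?d w ^ 2"
    using eventually_nearbyD[OF M(2)] by blast
  show ?thesis
  \<comment> \<open>The radius \<open>r\<close> validates the quadratic bound. The radius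
    \<open>1 / M\<close> makes \<open>M\<close> times the distance less than 1, so the bound falls
    strictly below the distance whenever that is positive, as it is once some point differs.\<close>
  proof (rule exI[of _ "min r (1 / M)"], rule exI[of _ M], intro conjI allI impI)
    show "0 < min r (1 / M)" "0 < M" using r M by simp_all
  next
    fix w
    assume w: "(\<forall>t\<in>{1..N}. w t \<in> NN t) \<and> feasible_dyn f N x1 (\<lambda>t. xu (w t)) \<and> ?d w < min r (1 / M)"
    then show q: "?d (?step w) \<le> M * (?d w)\<^sup>2"
      using r(2)[rule_format, of w] by (auto simp: iterates_def)
    assume "\<exists>t\<in>{1..N}. w t \<noteq> wstar t"
    then obtain t where t: "t \<in> {1..N}" "w t \<noteq> wstar t" by blast
    then have "0 < dist (wstar t) (w t)" by simp
    also have "\<dots> \<le> ?d w"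
      unfolding traj_dist_def by (rule member_le_L2_set[OF _ t(1)]) simp
    finally have pos: "0 < ?d w" .
    have "M * ?d w < 1" using w M(1) by (simp add: pos_less_divide_eq mult.commute)
    then have "M * (?d w)\<^sup>2 < ?d w"
      using pos by (simp add: power2_eq_square mult.assoc[symmetric])
    with q show "?d (?step w) < ?d w" by simp
  qed
qed

end
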